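(* Let $I\subseteq\mathbb{R}[x,y]=\mathbb{R}[x_1,\dots,x_n,y_1,\dots,y_n]$ be an ideal with the Quillen property (Q): every $f\in\mathbb{R}[x,y]$ that is strictly positive on $V_{\mathbb{R}}(I)$ lies in $\Sigma_h+I$. Then $I$ has the subnormality property (S): every tuple $T=(T_1,\dots,T_n)$ of pairwise commuting bounded linear operators on a Hilbert space satisfying $p(T,T^* )=0$ for every $p\in I$ is subnormal.
   Context: $\mathbb{C}[z,\bar z]$ is the polynomial ring in $2n$ independent variables $z=(z_1,\dots,z_n)$, $\bar z=(\bar z_1,\dots,\bar z_n)$, with the conjugate-linear ring involution $*$ determined by $z_j^*=\bar z_j$. Its fixed ring is $\mathbb{R}[x,y]$, where $x_j=\frac12(z_j+\bar z_j)$, $y_j=\frac1{2i}(z_j-\bar z_j)$. For $f\in\mathbb{C}[z,\bar z]$ and $a\in\mathbb{C}^n$, $f(a)$ denotes the value obtained by substituting $a$ for $z$ and $\bar a$ for $\bar z$. $V_{\mathbb{R}}(I)=\{a\in\mathbb{C}^n: f(a)=0\ \forall f\in I\}$. $\Sigma_h$ is the convex cone in $\mathbb{R}[x,y]$ generated by $\{|p|^2=pp^*: p\in\mathbb{C}[z]\}$ (hermitian sums of squares). Hilbert spaces are complex and separable. Hereditary calculus: for a commuting tuple $T$ of bounded operators and $f=\sum_{\alpha,\beta}a_{\alpha,\beta}z^\alpha\bar z^\beta$, $f(T,T^* )=\sum_{\alpha,\beta}a_{\alpha,\beta}T^{*\beta}T^\alpha$ (all adjoints to the left). A commuting tuple $T$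 on $E$ is subnormal if there are a Hilbert space $E'\supseteq E$ and a tuple $(T_1',\dots,T_n')$ of pairwise commuting bounded normal operators on $E'$ that leave $E$ invariant and satisfy $T_i'|_E=T_i$ for all $i$. *)

theory Defs
  imports
    "HOL-Analysis.Analysis"
    "HOL-Analysis.Finite_Function_Topology"
    "HOL-Library.Function_Algebras"
begin

section \<open>The polynomial ring \<open>\<complex>[z, zbar]\<close>\<close>

text \<open>
  The variables are indexed by a finite type \<open>'n\<close>. The key \<open>(\<alpha>, \<beta>)\<close> stands for the monomial
  \<open>z\<^sup>\<alpha> zbar\<^sup>\<beta>\<close>, so that the multiplication of \<open>poly_mapping\<close> is the one of the polynomial ring
  in the \<open>2n\<close> independent variables \<open>z\<close>, \<open>zbar\<close>.
\<close>

type_synonym 'n zpoly = "('n \<Rightarrow>\<^sub>0 nat) \<times> ('n \<Rightarrow>\<^sub>0 nat) \<Rightarrow>\<^sub>0 complex"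

definition star :: "'n zpoly \<Rightarrow> 'n zpoly"
  where "star f =
    (\<Sum>(\<alpha>, \<beta>)\<in>Poly_Mapping.keys f.
       Poly_Mapping.single (\<beta>, \<alpha>) (cnj (Poly_Mapping.lookup f (\<alpha>, \<beta>))))"

lemma lookup_star:
  "Poly_Mapping.lookup (star f) (\<alpha>, \<beta>) = cnj (Poly_Mapping.lookup f (\<beta>, \<alpha>))"
proof -
  have "Poly_Mapping.lookup (star f) (\<alpha>, \<beta>) =
      (\<Sum>k\<in>Poly_Mapping.keys f. if k = (\<beta>, \<alpha>) then cnj (Poly_Mapping.lookup f k) else 0)"
    unfolding star_def lookup_sum
    by (rule sum.cong) (auto simp: lookup_single when_def split: prod.splits)
  then show ?thesis
    by (simp add: in_keys_iff)
qed

lemma star_star: "star (star f) = f"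
  by (rule poly_mapping_eqI) (auto simp: lookup_star)

lemma star_add: "star (f + g) = star f + star g"
  by (rule poly_mapping_eqI) (auto simp: lookup_star lookup_add)

lemma star_single: "star (Poly_Mapping.single (\<alpha>, \<beta>) c) = Poly_Mapping.single (\<beta>, \<alpha>) (cnj c)"
  by (rule poly_mapping_eqI) (force simp: lookup_star lookup_single when_def)

lemma star_zero: "star 0 = 0"
  by (simp add: star_def)

lemma star_sum: "star (\<Sum>x\<in>A. f x) = (\<Sum>x\<in>A. star (f x))"
  by (induction A rule: infinite_finite_induct) (simp_all add: star_zero star_add)

lemma star_mult: "star (f * g) = star f * star g"
proof -
  have dec: "h = (\<Sum>k\<in>Poly_Mapping.keys h. Poly_Mapping.single k (Poly_Mapping.lookup h k))"
    for h :: "'a zpoly"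
    by (rule poly_mapping_eqI) (simp add: lookup_sum lookup_single when_def in_keys_iff)
  have s: "star (Poly_Mapping.single k c * Poly_Mapping.single l d) =
      star (Poly_Mapping.single k c) * star (Poly_Mapping.single l d)"
    for k l :: "('a \<Rightarrow>\<^sub>0 nat) \<times> ('a \<Rightarrow>\<^sub>0 nat)" and c d
    by (cases k; cases l) (simp add: mult_single star_single)
  show ?thesis
    by (subst (1 2) dec[of f], subst (1 2) dec[of g])
      (simp only: sum_product star_sum s)
qed

text \<open>\<open>\<real>[x, y]\<close>, as the fixed ring of the involution.\<close>

definition real_polys :: "'n zpoly set"
  where "real_polys = {f. star f = f}"

definition holo_polys :: "'n zpoly set"
  where "holo_polys = {p. \<forall>(\<alpha>, \<beta>)\<in>Poly_Mapping.keys p. \<beta> = 0}"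

definition zeval :: "'n::finite zpoly \<Rightarrow> complex ^ 'n \<Rightarrow> complex"
  where "zeval f a =
    (\<Sum>(\<alpha>, \<beta>)\<in>Poly_Mapping.keys f. Poly_Mapping.lookup f (\<alpha>, \<beta>) *
       (\<Prod>i\<in>UNIV. (a $ i) ^ Poly_Mapping.lookup \<alpha> i) *
       (\<Prod>i\<in>UNIV. cnj (a $ i) ^ Poly_Mapping.lookup \<beta> i))"

definition real_ideal :: "'n zpoly set \<Rightarrow> bool"
  where "real_ideal I \<longleftrightarrow> I \<subseteq> real_polys \<and> 0 \<in> I \<and>
    (\<forall>f\<in>I. \<forall>g\<in>I. f + g \<in> I) \<and> (\<forall>r\<in>real_polys. \<forall>f\<in>I. r * f \<in> I)"

definition real_zeros :: "'n::finite zpoly set \<Rightarrow> (complex ^ 'n) set"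
  where "real_zeros I = {a. \<forall>f\<in>I. zeval f a = 0}"

definition hermitian_sos :: "'n zpoly set"
  where "hermitian_sos = convex_cone hull {p * star p | p. p \<in> holo_polys}"

text \<open>Elements of \<open>\<real>[x, y]\<close> take real values, so \<open>Re\<close> below only changes the type.\<close>

definition quillen_property :: "'n::finite zpoly set \<Rightarrow> bool"
  where "quillen_property I \<longleftrightarrow>
    (\<forall>f\<in>real_polys. (\<forall>a\<in>real_zeros I. 0 < Re (zeval f a)) \<longrightarrow>
       (\<exists>s\<in>hermitian_sos. \<exists>g\<in>I. f = s + g))"


section \<open>Complex Hilbert spaces\<close>

text \<open>
  The Hilbert space has carrier \<open>H\<close>, a linear subspace of an ambient complex vector space without
  topology; the inner product \<open>ip\<close> is linear in the first argument, and its values outside \<open>H\<close>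
  are irrelevant. Similarly, only the values on \<open>H\<close> of an operator on \<open>H\<close> matter.
\<close>

locale complex_inner_space = vector_space scale
  for scale :: "complex \<Rightarrow> 'a::ab_group_add \<Rightarrow> 'a" (infixr \<open>*s\<close> 75) +
  fixes H :: "'a set" and ip :: "'a \<Rightarrow> 'a \<Rightarrow> complex"
  assumes subspace_carrier: "subspace H"
    and ip_add_left: "\<lbrakk>x \<in> H; y \<in> H; z \<in> H\<rbrakk> \<Longrightarrow> ip (x + y) z = ip x z + ip y z"
    and ip_scale_left: "\<lbrakk>x \<in> H; y \<in> H\<rbrakk> \<Longrightarrow> ip (c *s x) y = c * ip x y"
    and ip_cnj: "\<lbrakk>x \<in> H; y \<in> H\<rbrakk> \<Longrightarrow> ip x y = cnj (ip y x)"
    and ip_pos: "\<lbrakk>x \<in> H; x \<noteq> 0\<rbrakk> \<Longrightarrow> 0 < Re (ip x x)"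
begin

definition hnorm :: "'a \<Rightarrow> real"
  where "hnorm x = sqrt (Re (ip x x))"

text \<open>\<open>Metric_space\<close> requires nonnegativity and symmetry also outside the carrier.\<close>

definition hdist :: "'a \<Rightarrow> 'a \<Rightarrow> real"
  where "hdist x y = (if x \<in> H \<and> y \<in> H then hnorm (x - y) else 0)"

lemma ip_zero: "x \<in> H \<Longrightarrow> ip 0 x = 0"
  using ip_scale_left[of x x 0] by simp

lemma Re_ip_commute: "\<lbrakk>x \<in> H; y \<in> H\<rbrakk> \<Longrightarrow> Re (ip x y) = Re (ip y x)"
  using ip_cnj[of x y] by simp

lemma ip_nonneg: "x \<in> H \<Longrightarrow> 0 \<le> Re (ip x x)"
  using ip_pos[of x] ip_zero[of x] by (cases "x = 0") auto

lemma Re_ip_expand: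
  assumes "x \<in> H" "y \<in> H"
  shows "Re (ip (x + of_real t *s y) (x + of_real t *s y)) =
    Re (ip x x) + 2 * t * Re (ip x y) + t\<^sup>2 * Re (ip y y)"
proof -
  let ?u = "of_real t *s y"
  have u: "?u \<in> H" and xu: "x + ?u \<in> H"
    using assms subspace_carrier by (auto intro: subspace_scale subspace_add)
  have "Re (ip (x + ?u) z) = Re (ip x z) + t * Re (ip y z)" if "z \<in> H" for z
    using assms u that by (simp add: ip_add_left ip_scale_left)
  note exp = this
  have "Re (ip (x + ?u) (x + ?u)) = Re (ip x (x + ?u)) + t * Re (ip y (x + ?u))"
    using exp xu by blast
  also have "\<dots> = Re (ip (x + ?u) x) + t * Re (ip (x + ?u) y)"
    using assms xu by (simp add: Re_ip_commute)
  also have "\<dots> = Re (ip x x) + t * Re (ip y x) + t * (Re (ip x y) + t * Re (ip y y))"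
    using exp assms by simp
  finally show ?thesis
    using assms by (simp add: Re_ip_commute[of y x] algebra_simps power2_eq_square)
qed

lemma Re_ip_le:
  assumes "x \<in> H" "y \<in> H"
  shows "Re (ip x y) \<le> hnorm x * hnorm y"
proof (cases "y = 0")
  case True
  then show ?thesis
    using assms Re_ip_commute[of x y] by (simp add: ip_zero hnorm_def)
next
  case False
  let ?A = "Re (ip x x)" and ?B = "Re (ip y y)" and ?R = "Re (ip x y)"
  have B: "?B > 0" using False assms ip_pos by blast
  let ?t = "- ?R / ?B"
  have "x + of_real ?t *s y \<in> H"
    using assms subspace_carrier by (intro subspace_add subspace_scale)
  then have "0 \<le> ?A + 2 * ?t * ?R + ?t\<^sup>2 * ?B"
    using ip_nonneg Re_ip_expand[OF assms] by metis
  also have "\<dots> = ?A - ?R\<^sup>2 / ?B"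
    using B by (simp add: field_simps power2_eq_square)
  finally have "?R\<^sup>2 \<le> ?A * ?B"
    using B by (simp add: field_simps)
  then have "\<bar>?R\<bar> \<le> sqrt (?A * ?B)"
    using real_le_rsqrt[of "\<bar>?R\<bar>"] by simp
  then show ?thesis
    by (simp add: hnorm_def real_sqrt_mult)
qed

lemma hnorm_nonneg: "x \<in> H \<Longrightarrow> 0 \<le> hnorm x"
  by (simp add: hnorm_def ip_nonneg)

lemma hnorm_triangle:
  assumes "x \<in> H" "y \<in> H"
  shows "hnorm (x + y) \<le> hnorm x + hnorm y"
proof -
  have "Re (ip (x + y) (x + y)) = (hnorm x)\<^sup>2 + 2 * Re (ip x y) + (hnorm y)\<^sup>2"
    using Re_ip_expand[OF assms, of 1] assms by (simp add: hnorm_def ip_nonneg)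
  also have "\<dots> \<le> (hnorm x + hnorm y)\<^sup>2"
    using Re_ip_le[OF assms] by (simp add: power2_sum)
  finally show ?thesis
    unfolding hnorm_def[of "x + y"] using assms hnorm_nonneg by (simp add: real_le_lsqrt)
qed

lemma hnorm_minus_commute:
  assumes "x \<in> H" "y \<in> H"
  shows "hnorm (x - y) = hnorm (y - x)"
proof -
  have H: "x - y \<in> H" "0 \<in> H"
    using assms subspace_carrier by (auto intro: subspace_diff subspace_0)
  have "0 + of_real (-1) *s (x - y) = y - x"
    by simp
  then show ?thesis
    using Re_ip_expand[OF H(2,1), of "-1"] H by (simp add: hnorm_def ip_zero)
qed

sublocale Metric_space H hdist
proof
  show "0 \<le> hdist x y" for x y
    using subspace_carrier by (auto simp: hdist_def intro!: hnorm_nonneg subspace_diff)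
  show "hdist x y = hdist y x" for x y
    by (auto simp: hdist_def hnorm_minus_commute)
  show "hdist x y = 0 \<longleftrightarrow> x = y" if "x \<in> H" "y \<in> H" for x y
  proof -
    have "x - y \<in> H"
      using that subspace_carrier by (auto intro: subspace_diff)
    then have "hnorm (x - y) = 0 \<longleftrightarrow> x - y = 0"
      using ip_pos[of "x - y"] ip_zero[of "x - y"] by (cases "x - y = 0") (auto simp: hnorm_def)
    then show ?thesis
      using that by (simp add: hdist_def)
  qed
  show "hdist x z \<le> hdist x y + hdist y z" if "x \<in> H" "y \<in> H" "z \<in> H" for x y z
    using hnorm_triangle[of "x - y" "y - z"] that subspace_carrier
    by (auto simp: hdist_def intro: subspace_diff)
qed

definition bounded_op :: "('a \<Rightarrow> 'a) \<Rightarrow> bool"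
  where "bounded_op T \<longleftrightarrow>
    T ` H \<subseteq> H \<and>
    (\<forall>x\<in>H. \<forall>y\<in>H. T (x + y) = T x + T y) \<and>
    (\<forall>c. \<forall>x\<in>H. T (c *s x) = c *s T x) \<and>
    (\<exists>K. \<forall>x\<in>H. hnorm (T x) \<le> K * hnorm x)"

text \<open>Meaningful for bounded operators on Hilbert spaces, by the Riesz representation theorem.\<close>

definition hadjoint :: "('a \<Rightarrow> 'a) \<Rightarrow> 'a \<Rightarrow> 'a"
  where "hadjoint T y = (THE z. z \<in> H \<and> (\<forall>x\<in>H. ip (T x) y = ip x z))"

definition normal_op :: "('a \<Rightarrow> 'a) \<Rightarrow> bool"
  where "normal_op T \<longleftrightarrow> bounded_op T \<and> (\<forall>x\<in>H. hadjoint T (T x) = T (hadjoint T x))"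

definition commuting_tuple :: "('n \<Rightarrow> 'a \<Rightarrow> 'a) \<Rightarrow> bool"
  where "commuting_tuple T \<longleftrightarrow>
    (\<forall>i. bounded_op (T i)) \<and> (\<forall>i j. \<forall>x\<in>H. T i (T j x) = T j (T i x))"

end

locale hilbert_space = complex_inner_space +
  assumes complete: mcomplete
    and separable: "separable_space mtopology"


section \<open>Hereditary calculus and subnormality\<close>

text \<open>The order of the factors is immaterial for commuting tuples, so any enumeration will do.\<close>

definition tuple_power :: "('n::finite \<Rightarrow> 'a \<Rightarrow> 'a) \<Rightarrow> ('n \<Rightarrow>\<^sub>0 nat) \<Rightarrow> 'a \<Rightarrow> 'a"
  where "tuple_power T \<alpha> =
    foldr (\<lambda>i S. (T i ^^ Poly_Mapping.lookup \<alpha> i) \<circ> S)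
      (SOME is. distinct is \<and> set is = (UNIV :: 'n set)) id"

context complex_inner_space
begin

definition hereditary :: "'n::finite zpoly \<Rightarrow> ('n \<Rightarrow> 'a \<Rightarrow> 'a) \<Rightarrow> 'a \<Rightarrow> 'a"
  where "hereditary f T x =
    (\<Sum>(\<alpha>, \<beta>)\<in>Poly_Mapping.keys f. Poly_Mapping.lookup f (\<alpha>, \<beta>) *s
       tuple_power (\<lambda>i. hadjoint (T i)) \<beta> (tuple_power T \<alpha> x))"

text \<open>
  The inclusion \<open>E \<subseteq> E'\<close> is rendered by an isometric linear embedding \<open>J\<close>. As HOL cannot quantify
  existentially over types, \<open>E'\<close> ranges over all Hilbert spaces whose underlying vector space is a
  subspace of \<open>\<complex>\<^sup>\<nat>\<close>. Up to isometric isomorphism, these are all separable Hilbert spaces: for a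
  dense sequence \<open>d\<close> transport the structure along the linear injection \<open>x \<mapsto> (\<lambda>k. \<langle>x, d k\<rangle>)\<close>.
\<close>

definition subnormal :: "('n \<Rightarrow> 'a \<Rightarrow> 'a) \<Rightarrow> bool"
  where "subnormal T \<longleftrightarrow>
    (\<exists>scale' (H' :: (nat \<Rightarrow> complex) set) ip' J T'.
       scale' = (\<lambda>c x k. c * x k) \<and>
       hilbert_space scale' H' ip' \<and>
       J ` H \<subseteq> H' \<and>
       (\<forall>x\<in>H. \<forall>y\<in>H. J (x + y) = J x + J y) \<and>
       (\<forall>c. \<forall>x\<in>H. J (c *s x) = scale' c (J x)) \<and>
       (\<forall>x\<in>H. \<forall>y\<in>H. ip' (J x) (J y) = ip x y) \<and>
       complex_inner_space.commuting_tuple scale' H' ip' T' \<and>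
       (\<forall>i. complex_inner_space.normal_op scale' H' ip' (T' i)) \<and>
       (\<forall>i. T' i ` (J ` H) \<subseteq> J ` H) \<and>
       (\<forall>i. \<forall>x\<in>H. T' i (J x) = J (T i x)))"

end

definition subnormality_property :: "'a::ab_group_add itself \<Rightarrow> 'n::finite zpoly set \<Rightarrow> bool"
  where "subnormality_property _ I \<longleftrightarrow>
    (\<forall>scale (H :: 'a set) ip T.
       hilbert_space scale H ip \<and>
       complex_inner_space.commuting_tuple scale H ip T \<and>
       (\<forall>p\<in>I. \<forall>x\<in>H. complex_inner_space.hereditary scale H ip p T x = 0) \<longrightarrow>
       complex_inner_space.subnormal scale H ip T)"

end

theory Submission
  imports Defs
begin

text \<open>
  Let \<open>f\<close> be a real polynomial that is nonnegative on a polydisc of radius \<open>R > \<parallel>T\<^sub>i\<parallel>\<close>. Adding a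
  multiple of \<open>\<Sum>\<^sub>i \<bar>z\<^sub>i / R\<bar>\<^bsup>2k\<^esup>\<close> and a small constant makes it strictly positive everywhere, so that (Q)
  and \<open>p(T, T\<^sup>*) = 0\<close> for \<open>p \<in> I\<close> give \<open>f(T, T\<^sup>*) \<ge> 0\<close> in the limit. A polynomial partition of unity
  extends this to matrices of polynomials, so that \<open>\<langle>f \<otimes> x, g \<otimes> y\<rangle> = \<langle>(f g\<^sup>*)(T, T\<^sup>*) x, y\<rangle>\<close> is a
  semi-inner product on \<open>\<complex>[z, zbar] \<otimes> H\<close>. On its completion, multiplication by \<open>z\<^sub>i\<close> is bounded by \<open>R\<close>
  and has multiplication by \<open>zbar\<^sub>i\<close> as its adjoint, hence is normal, and it extends \<open>T\<^sub>i\<close> on the copy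
  \<open>1 \<otimes> H\<close> of \<open>H\<close>.
\<close>

(* Otherwise \<open>*s\<close> is ambiguous between the locale parameter and the scaling of HOL-Analysis vectors. *)
no_notation vector_scalar_mult (infixl "*s" 70)


section \<open>Polynomials and their values\<close>

text \<open>The hereditary calculus is linear but not multiplicative: with all adjoints on the left,
  \<open>f * star f\<close> is in general turned into a visibly positive operator only when f is
  holomorphic in z. Positivity of the form on the whole ring tensored with \<open>H\<close>
  therefore has to come from pointwise positivity. There the obstacle is that
  \<open>real_zeros I\<close> may be unbounded, while approximation by polynomials needs a compact
  set; the strict gap between the common bound of the operators and R pays for the passage, as it
  makes the correction terms small on T. The completion has to consist of functions from nat to
  complex. A vector is recorded by its inner products with a countable dense family that is closed
  under multiplication by monomials. Multiplication by z_i then becomes precomposition with a map of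
  indices: it is linear by its form, and commutation and normality reduce to commutation of index
  maps.\<close>

definition lin_ext :: "('k \<Rightarrow> complex) \<Rightarrow> ('k \<Rightarrow>\<^sub>0 complex) \<Rightarrow> complex"
  where "lin_ext \<phi> f = (\<Sum>k\<in>Poly_Mapping.keys f. Poly_Mapping.lookup f k * \<phi> k)"

lemma lin_ext_superset:
  assumes "finite S" "Poly_Mapping.keys f \<subseteq> S"
  shows "lin_ext \<phi> f = (\<Sum>k\<in>S. Poly_Mapping.lookup f k * \<phi> k)"
  unfolding lin_ext_def
  by (rule sum.mono_neutral_left) (use assms in \<open>auto simp: in_keys_iff\<close>)

lemma lin_ext_0: "lin_ext \<phi> 0 = 0"
  by (simp add: lin_ext_def)

lemma lin_ext_add: "lin_ext \<phi> (f + g) = lin_ext \<phi> f + lin_ext \<phi> g"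
proof -
  let ?S = "Poly_Mapping.keys f \<union> Poly_Mapping.keys g"
  have "Poly_Mapping.keys (f + g) \<subseteq> ?S"
    by (rule Poly_Mapping.keys_add)
  then show ?thesis
    by (simp add: lin_ext_superset[of ?S] lookup_add ring_distribs sum.distrib)
qed

lemma lin_ext_uminus: "lin_ext \<phi> (- f) = - lin_ext \<phi> f"
  using lin_ext_add[of \<phi> f "- f"] by (simp add: lin_ext_0 add_eq_0_iff)

lemma lin_ext_diff: "lin_ext \<phi> (f - g) = lin_ext \<phi> f - lin_ext \<phi> g"
  using lin_ext_add[of \<phi> f "- g"] by (simp add: lin_ext_uminus)

lemma lin_ext_sum: "lin_ext \<phi> (\<Sum>x\<in>A. f x) = (\<Sum>x\<in>A. lin_ext \<phi> (f x))"
  by (induction A rule: infinite_finite_induct) (simp_all add: lin_ext_0 lin_ext_add)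

lemma lin_ext_single: "lin_ext \<phi> (Poly_Mapping.single k c) = c * \<phi> k"
  by (simp add: lin_ext_def)

lemma poly_mapping_sum_single:
  "(\<Sum>k\<in>Poly_Mapping.keys h. Poly_Mapping.single k (Poly_Mapping.lookup h k)) = h"
  by (rule poly_mapping_eqI) (simp add: lookup_sum lookup_single when_def in_keys_iff)

lemma poly_mapping_induct [case_names single add]:
  fixes f :: "'k \<Rightarrow>\<^sub>0 complex"
  assumes "\<And>k c. P (Poly_Mapping.single k c)" "\<And>f g. P f \<Longrightarrow> P g \<Longrightarrow> P (f + g)"
  shows "P f"
proof -
  have 0: "P 0"
    using assms(1)[of undefined 0] by simp
  have "P (\<Sum>k\<in>S. Poly_Mapping.single k (Poly_Mapping.lookup f k))" if "finite S" for S
    using that by (induction S rule: finite_induct) (simp_all add: assms 0)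
  then show ?thesis
    using poly_mapping_sum_single[of f] finite_keys by metis
qed

abbreviation const_poly :: "complex \<Rightarrow> 'n zpoly"
  where "const_poly c \<equiv> Poly_Mapping.single 0 c"

lemma lin_ext_const_mult: "lin_ext \<phi> (const_poly c * f) = c * lin_ext \<phi> f"
  by (induction f rule: poly_mapping_induct)
    (simp_all add: mult_single lin_ext_single lin_ext_add distrib_left)

lemma star_const: "star (const_poly c) = const_poly (cnj c)"
  by (simp add: zero_prod_def star_single)

lemma star_one: "star 1 = 1"
  using star_const[of 1] by simp

lemma star_diff: "star (f - g) = star f - star g"
  using star_add[of "f - g" g] by simp

lemma lookup_const_mult:
  "Poly_Mapping.lookup (const_poly c * f) k = c * Poly_Mapping.lookup f k"
  by (induction f rule: poly_mapping_induct)
    (simp_all add: mult_single lookup_single lookup_add distrib_left when_def)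

text \<open>\<open>hermitian_sos\<close> is a convex cone for the real scaling that comes with the
  type of finitely supported functions; here that scaling is identified with multiplication in the
  ring.\<close>

lemma scaleR_eq_const_mult: "r *\<^sub>R f = const_poly (of_real r) * (f :: 'n zpoly)"
proof (rule poly_mapping_eqI)
  fix k
  have "finite {i. r *\<^sub>R Poly_Mapping.lookup f i \<noteq> 0}"
    by (rule finite_subset[OF _ finite_keys[of f]]) (auto simp: in_keys_iff)
  then show "Poly_Mapping.lookup (r *\<^sub>R f) k = Poly_Mapping.lookup (const_poly (of_real r) * f) k"
    by (simp add: scaleR_poly_mapping_def Abs_poly_mapping_inverse lookup_const_mult scaleR_conv_of_real)
qed

section \<open>Evaluation of polynomials at points\<close>

definition mono_eval :: "complex ^ 'n::finite \<Rightarrow> ('n \<Rightarrow>\<^sub>0 nat) \<times> ('n \<Rightarrow>\<^sub>0 nat) \<Rightarrow> complex"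
  where "mono_eval a k =
    (\<Prod>i\<in>UNIV. (a $ i) ^ Poly_Mapping.lookup (fst k) i) *
    (\<Prod>i\<in>UNIV. cnj (a $ i) ^ Poly_Mapping.lookup (snd k) i)"

text \<open>Evaluation and, later, the hereditary calculus are both linear extensions of a function
  on monomials, so they share the rules of \<open>lin_ext\<close>.\<close>

lemma zeval_lin_ext: "zeval f a = lin_ext (mono_eval a) f"
  by (simp add: zeval_def lin_ext_def mono_eval_def case_prod_beta mult.assoc)

lemma mono_eval_add: "mono_eval a (k + l) = mono_eval a k * mono_eval a l"
  by (simp add: mono_eval_def lookup_add power_add prod.distrib)

lemma mono_eval_0: "mono_eval a 0 = 1"
  by (simp add: mono_eval_def)

lemma mono_eval_swap: "mono_eval a (prod.swap k) = cnj (mono_eval a k)"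
  by (simp add: mono_eval_def)

lemma zeval_add: "zeval (f + g) a = zeval f a + zeval g a"
  by (simp add: zeval_lin_ext lin_ext_add)

lemma zeval_diff: "zeval (f - g) a = zeval f a - zeval g a"
  by (simp add: zeval_lin_ext lin_ext_diff)

lemma zeval_sum: "zeval (\<Sum>x\<in>A. f x) a = (\<Sum>x\<in>A. zeval (f x) a)"
  by (simp add: zeval_lin_ext lin_ext_sum)

lemma zeval_single: "zeval (Poly_Mapping.single k c) a = c * mono_eval a k"
  by (simp add: zeval_lin_ext lin_ext_single)

lemma zeval_const: "zeval (const_poly c) a = c"
  by (simp add: zeval_single mono_eval_0)

lemma zeval_mult: "zeval (f * g) a = zeval f a * zeval g a"
proof (induction f rule: poly_mapping_induct)
  case (single k c)
  show ?case
    by (induction g rule: poly_mapping_induct)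
      (simp_all add: mult_single zeval_single mono_eval_add zeval_add distrib_left)
qed (simp add: zeval_add distrib_right)

lemma zeval_star: "zeval (star f) a = cnj (zeval f a)"
proof (induction f rule: poly_mapping_induct)
  case (single k c)
  then show ?case
    using mono_eval_swap[of a k] by (cases k) (simp add: star_single zeval_single)
qed (simp add: zeval_add star_add)

lemma zeval_real_polys: "f \<in> real_polys \<Longrightarrow> zeval f a = of_real (Re (zeval f a))"
  using zeval_star[of f a] by (simp add: real_polys_def complex_eq_iff)

lemma real_polys_add: "f \<in> real_polys \<Longrightarrow> g \<in> real_polys \<Longrightarrow> f + g \<in> real_polys"
  by (simp add: real_polys_def star_add)

lemma real_polys_diff: "f \<in> real_polys \<Longrightarrow> g \<in> real_polys \<Longrightarrow> f - g \<in> real_polys"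
  by (simp add: real_polys_def star_diff)

lemma real_polys_mult: "f \<in> real_polys \<Longrightarrow> g \<in> real_polys \<Longrightarrow> f * g \<in> real_polys"
  by (simp add: real_polys_def star_mult)

lemma real_polys_const: "const_poly (of_real r) \<in> real_polys"
  by (simp add: real_polys_def star_const)

lemma real_polys_sum: "(\<And>x. x \<in> A \<Longrightarrow> f x \<in> real_polys) \<Longrightarrow> (\<Sum>x\<in>A. f x) \<in> real_polys"
  by (simp add: real_polys_def star_sum)

lemma real_polys_single_diag: "Poly_Mapping.single (\<alpha>, \<alpha>) (of_real r) \<in> real_polys"
  by (simp add: real_polys_def star_single)

text \<open>Splitting along the fixed ring of the involution; the factor -i/2 in the second part is
  1/(2i).\<close>

lemma zpoly_real_imag_parts:
  fixes f :: "'n::finite zpoly"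
  obtains g h where "g \<in> real_polys" "h \<in> real_polys" "f = g + const_poly \<i> * h"
    "\<And>a. Re (zeval g a) = Re (zeval f a)" "\<And>a. Re (zeval h a) = Im (zeval f a)"
proof
  define g where "g = const_poly (1/2) * (f + star f)"
  define h where "h = const_poly (- \<i>/2) * (f - star f)"
  show "g \<in> real_polys"
    by (simp add: g_def real_polys_def star_mult star_add star_star star_const add.commute)
  have c: "const_poly (\<i> / 2) = - const_poly (- \<i> / 2)"
    by (simp add: single_uminus[symmetric])
  show "h \<in> real_polys"
    by (simp add: h_def real_polys_def star_mult star_diff star_star star_const c)
       (simp add: algebra_simps)
  have "const_poly \<i> * h = const_poly (1/2) * (f - star f)"
    by (simp add: h_def mult.assoc[symmetric] mult_single)
  then have "g + const_poly \<i> * h = (const_poly (1/2) + const_poly (1/2)) * f"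
    by (simp add: g_def algebra_simps)
  also have "\<dots> = f"
    by (simp add: single_add[symmetric])
  finally show "f = g + const_poly \<i> * h" ..
  show "Re (zeval g a) = Re (zeval f a)" "Re (zeval h a) = Im (zeval f a)" for a
    by (simp_all add: g_def h_def zeval_mult zeval_add zeval_diff zeval_star zeval_const)
qed

lemma continuous_on_zeval: "continuous_on S (zeval f)"
  unfolding zeval_def case_prod_beta by (intro continuous_intros)

text \<open>Brings the approximants of the Stone-Weierstrass theorem, which are functions, back into
  the polynomial ring.\<close>

lemma real_polynomial_function_zpoly:
  fixes g :: "complex ^ 'n::finite \<Rightarrow> real"
  assumes "real_polynomial_function g"
  obtains f where "f \<in> real_polys" "\<And>a. zeval f a = of_real (g a)"
proof -
  have "\<exists>f\<in>real_polys. \<forall>a. zeval f a = of_real (g a)"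
    using assms
  proof induction
    case (linear g)
    interpret bounded_linear g by fact
    define e :: "'n \<Rightarrow> 'n zpoly" where "e i = Poly_Mapping.single (Poly_Mapping.single i 1, 0) 1" for i
    have e: "zeval (e i) a = a $ i" for i a
    proof -
      have "(\<Prod>j\<in>UNIV. a $ j ^ Poly_Mapping.lookup (Poly_Mapping.single i 1) j) =
          (\<Prod>j\<in>UNIV. if j = i then a $ i else 1)"
        by (rule prod.cong) (auto simp: lookup_single)
      then show ?thesis
        by (simp add: e_def zeval_single mono_eval_def)
    qed
    have "\<exists>f\<in>real_polys. \<exists>g\<in>real_polys. \<forall>a. zeval f a = of_real (Re (a $ i)) \<and>
        zeval g a = of_real (Im (a $ i))" for i :: 'n
    proof -
      obtain f g where "f \<in> real_polys" "g \<in> real_polys"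
        "\<And>a. Re (zeval f a) = Re (a $ i)" "\<And>a. Re (zeval g a) = Im (a $ i)"
        using zpoly_real_imag_parts[of "e i"] by (metis e)
      then show ?thesis
        using zeval_real_polys by metis
    qed
    then have "\<forall>i::'n. \<exists>f g. f \<in> real_polys \<and> g \<in> real_polys \<and>
        (\<forall>a. zeval f a = of_real (Re (a $ i)) \<and> zeval g a = of_real (Im (a $ i)))"
      by blast
    then obtain X Y where XY: "\<forall>i::'n. X i \<in> real_polys \<and> Y i \<in> real_polys \<and>
        (\<forall>a. zeval (X i) a = of_real (Re (a $ i)) \<and> zeval (Y i) a = of_real (Im (a $ i)))"
      by metis
    \<comment> \<open>A real-linear \<open>g\<close> is determined by its values at the vectors e_i
      and i e_i; \<open>X i\<close> and \<open>Y i\<close> are the coordinates x_i and y_i.\<close>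
    let ?f = "\<Sum>i\<in>UNIV. X i * const_poly (of_real (g (axis i 1))) +
      Y i * const_poly (of_real (g (axis i \<i>)))"
    have "?f \<in> real_polys"
      by (intro real_polys_sum real_polys_add real_polys_mult real_polys_const) (use XY in auto)
    moreover have "zeval ?f a = of_real (g a)" for a
    proof -
      have "a = (\<Sum>i\<in>UNIV. Re (a $ i) *\<^sub>R axis i 1 + Im (a $ i) *\<^sub>R axis i \<i>)"
        by (simp add: vec_eq_iff axis_def if_distrib[of "\<lambda>x. _ *\<^sub>R x"] sum.distrib
            complex_eq_iff cong: if_cong)
      then have "g a = (\<Sum>i\<in>UNIV. Re (a $ i) * g (axis i 1) + Im (a $ i) * g (axis i \<i>))"
        by (metis (mono_tags, lifting) sum add scale real_scaleR_def sum.cong)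
      then show ?thesis
        by (simp add: zeval_sum zeval_add zeval_mult zeval_const XY)
    qed
    ultimately show ?case by blast
  next
    case (const c)
    then show ?case
      using real_polys_const zeval_const by blast
  next
    case (add f g)
    then show ?case
      using real_polys_add zeval_add by (metis of_real_add)
  next
    case (mult f g)
    then show ?case
      using real_polys_mult zeval_mult by (metis of_real_mult)
  qed
  then show ?thesis
    using that by blast
qed

section \<open>Polydiscs and the growth of polynomials\<close>

definition polydisc :: "real \<Rightarrow> (complex ^ 'n::finite) set"
  where "polydisc R = {a. \<forall>i. norm (a $ i) \<le> R}"

lemma compact_polydisc: "compact (polydisc R :: (complex ^ 'n::finite) set)"
proof -
  have "polydisc R = (\<Inter>i. {a :: complex ^ 'n. norm (a $ i) \<le> R})"
    by (auto simp: polydisc_def)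
  then have "closed (polydisc R :: (complex ^ 'n::finite) set)"
    by (auto intro!: closed_Collect_le continuous_intros)
  moreover have "norm a \<le> real CARD('n) * R" if "a \<in> polydisc R" for a :: "complex ^ 'n"
  proof -
    have "norm a \<le> (\<Sum>i\<in>UNIV. norm (a $ i))"
      by (simp add: norm_vec_def L2_set_le_sum)
    also have "\<dots> \<le> (\<Sum>i\<in>(UNIV :: 'n set). R)"
      using that by (intro sum_mono) (auto simp: polydisc_def)
    finally show ?thesis by simp
  qed
  ultimately show ?thesis
    by (auto simp: compact_eq_bounded_closed bounded_iff)
qed

text \<open>On the polydisc scaled by t, a monomial of total degree d is at most a constant times
  t^d; the restriction 1 \<le> t lets a sum use the larger of two degrees.\<close>

lemma zeval_growth:
  fixes f :: "'n::finite zpoly"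
  assumes "0 < R"
  obtains C d where "0 \<le> C" "\<And>a t. \<lbrakk>1 \<le> t; a \<in> polydisc (R * t)\<rbrakk> \<Longrightarrow> norm (zeval f a) \<le> C * t ^ d"
proof -
  have "\<exists>C d. 0 \<le> C \<and> (\<forall>a t. 1 \<le> t \<longrightarrow> a \<in> polydisc (R * t) \<longrightarrow> norm (zeval f a) \<le> C * t ^ d)"
  proof (induction f rule: poly_mapping_induct)
    case (single k c)
    define d where "d = (\<Sum>i\<in>UNIV. Poly_Mapping.lookup (fst k) i) + (\<Sum>i\<in>UNIV. Poly_Mapping.lookup (snd k) i)"
    have "norm (zeval (Poly_Mapping.single k c) a) \<le> (norm c * R ^ d) * t ^ d"
      if "1 \<le> t" "a \<in> polydisc (R * t)" for a t
    proof -
      have "norm (mono_eval a k) = (\<Prod>i\<in>UNIV. norm (a $ i) ^ Poly_Mapping.lookup (fst k) i) *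
          (\<Prod>i\<in>UNIV. norm (a $ i) ^ Poly_Mapping.lookup (snd k) i)"
        by (simp add: mono_eval_def norm_mult norm_power flip: prod_norm)
      also have "\<dots> \<le> (\<Prod>i\<in>UNIV. (R * t) ^ Poly_Mapping.lookup (fst k) i) *
          (\<Prod>i\<in>UNIV. (R * t) ^ Poly_Mapping.lookup (snd k) i)"
        using that assms
        by (intro mult_mono prod_mono conjI power_mono prod_nonneg zero_le_power mult_nonneg_nonneg)
          (auto simp: polydisc_def)
      also have "\<dots> = (R * t) ^ d"
        by (simp add: d_def power_add power_sum)
      finally have "norm c * norm (mono_eval a k) \<le> norm c * (R * t) ^ d"
        by (rule mult_left_mono) simp
      then show ?thesis
        by (simp add: zeval_single norm_mult power_mult_distrib)
    qed
    moreover have "0 \<le> norm c * R ^ d"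
      using assms by simp
    ultimately show ?case by blast
  next
    case (add f g)
    then obtain C d C' d' where *: "0 \<le> C" "0 \<le> C'"
      "\<And>a t. \<lbrakk>1 \<le> t; a \<in> polydisc (R * t)\<rbrakk> \<Longrightarrow> norm (zeval f a) \<le> C * t ^ d"
      "\<And>a t. \<lbrakk>1 \<le> t; a \<in> polydisc (R * t)\<rbrakk> \<Longrightarrow> norm (zeval g a) \<le> C' * t ^ d'"
      by metis
    have "norm (zeval (f + g) a) \<le> (C + C') * t ^ (max d d')" if "1 \<le> t" "a \<in> polydisc (R * t)" for a t
    proof -
      have "norm (zeval (f + g) a) \<le> C * t ^ d + C' * t ^ d'"
        using norm_triangle_ineq *(3,4)[OF that] unfolding zeval_add by (meson add_mono order_trans)
      also have "\<dots> \<le> C * t ^ (max d d') + C' * t ^ (max d d')"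
        using that * by (intro add_mono mult_left_mono power_increasing) auto
      finally show ?thesis by (simp add: algebra_simps)
    qed
    then show ?case
      using *(1,2) by (metis add_nonneg_nonneg)
  qed
  then show ?thesis
    using that by blast
qed


section \<open>Hilbert spaces and commuting tuples\<close>

context complex_inner_space
begin

lemmas carrier_simps =
  subspace_0[OF subspace_carrier] subspace_add[OF subspace_carrier]
  subspace_diff[OF subspace_carrier] subspace_scale[OF subspace_carrier]
  subspace_sum[OF subspace_carrier]

lemma ip_diff_left: "\<lbrakk>x \<in> H; y \<in> H; z \<in> H\<rbrakk> \<Longrightarrow> ip (x - y) z = ip x z - ip y z"
  using ip_add_left[of "x - y" y z] by (simp add: carrier_simps)

lemma ip_add_right: "\<lbrakk>x \<in> H; y \<in> H; z \<in> H\<rbrakk> \<Longrightarrow> ip x (y + z) = ip x y + ip x z"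
  using ip_cnj[of x "y + z"] ip_cnj[of x y] ip_cnj[of x z] by (simp add: carrier_simps ip_add_left)

lemma ip_diff_right: "\<lbrakk>x \<in> H; y \<in> H; z \<in> H\<rbrakk> \<Longrightarrow> ip x (y - z) = ip x y - ip x z"
  using ip_add_right[of x "y - z" z] by (simp add: carrier_simps)

lemma ip_scale_right: "\<lbrakk>x \<in> H; y \<in> H\<rbrakk> \<Longrightarrow> ip x (c *s y) = cnj c * ip x y"
  using ip_cnj[of x "c *s y"] ip_cnj[of x y] by (simp add: carrier_simps ip_scale_left)

lemma ip_zero_right: "x \<in> H \<Longrightarrow> ip x 0 = 0"
  using ip_cnj[of x 0] ip_zero[of x] by (simp add: carrier_simps)

lemma ip_sum_left:
  "\<lbrakk>\<And>i. i \<in> A \<Longrightarrow> f i \<in> H; y \<in> H\<rbrakk> \<Longrightarrow> ip (\<Sum>i\<in>A. f i) y = (\<Sum>i\<in>A. ip (f i) y)"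
  by (induction A rule: infinite_finite_induct) (simp_all add: ip_zero ip_add_left carrier_simps)

lemma ip_sum_right:
  "\<lbrakk>\<And>i. i \<in> A \<Longrightarrow> f i \<in> H; y \<in> H\<rbrakk> \<Longrightarrow> ip y (\<Sum>i\<in>A. f i) = (\<Sum>i\<in>A. ip y (f i))"
  by (induction A rule: infinite_finite_induct) (simp_all add: ip_zero_right ip_add_right carrier_simps)

lemma ip_self: "x \<in> H \<Longrightarrow> ip x x = of_real ((hnorm x)\<^sup>2)"
  using ip_cnj[of x x] by (simp add: hnorm_def ip_nonneg complex_eq_iff)

lemma hnorm_power2: "x \<in> H \<Longrightarrow> (hnorm x)\<^sup>2 = Re (ip x x)"
  by (simp add: hnorm_def ip_nonneg)

lemma hnorm_scale:
  assumes "x \<in> H"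
  shows "hnorm (c *s x) = norm c * hnorm x"
proof -
  have "ip (c *s x) (c *s x) = (c * cnj c) * ip x x"
    using assms by (simp add: carrier_simps ip_scale_left ip_scale_right)
  also have "c * cnj c = of_real ((norm c)\<^sup>2)"
    by (rule complex_norm_square[symmetric])
  finally have "Re (ip (c *s x) (c *s x)) = (norm c)\<^sup>2 * Re (ip x x)"
    by (simp only: Re_complex_of_real times_complex.sel Im_complex_of_real mult_zero_left diff_zero)
  then show ?thesis
    by (simp add: hnorm_def real_sqrt_mult)
qed

lemma norm_ip_le:
  assumes "x \<in> H" "y \<in> H"
  shows "norm (ip x y) \<le> hnorm x * hnorm y"
proof (cases "ip x y = 0")
  case True
  then show ?thesis using assms by (simp add: hnorm_nonneg)
next
  case False
  \<comment> \<open>Rotating \<open>x\<close> by the conjugate phase makes the inner product real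
    and nonnegative, where \<open>Re_ip_le\<close> suffices.\<close>
  define c where "c = cnj (sgn (ip x y))"
  have "c * ip x y = of_real (norm (ip x y))"
    using False complex_norm_square[of "ip x y"]
    by (simp add: c_def sgn_div_norm scaleR_conv_of_real power2_eq_square field_simps)
  then have "norm (ip x y) = Re (ip (c *s x) y)"
    using assms by (simp add: ip_scale_left)
  also have "\<dots> \<le> hnorm (c *s x) * hnorm y"
    using assms by (intro Re_ip_le) (auto simp: carrier_simps)
  also have "hnorm (c *s x) = hnorm x"
    using assms False by (simp add: hnorm_scale c_def norm_sgn)
  finally show ?thesis .
qed

lemma ip_right_cancel:
  assumes "y \<in> H" "z \<in> H" "\<And>x. x \<in> H \<Longrightarrow> ip x y = ip x z"
  shows "y = z"
proof -
  have "ip (y - z) (y - z) = 0"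
    using assms by (simp add: ip_diff_right carrier_simps)
  then show ?thesis
    using assms ip_pos[of "y - z"] by (force simp: carrier_simps)
qed

text \<open>\<open>hadjoint\<close> is a definite description and inner products separate vectors,
  so a candidate for the adjoint only has to satisfy the defining identity.\<close>

lemma hadjoint_eqI:
  assumes "y \<in> H" "z \<in> H" "\<And>x. x \<in> H \<Longrightarrow> ip (T x) y = ip x z"
  shows "hadjoint T y = z"
  unfolding hadjoint_def
  by (rule the_equality) (use assms ip_right_cancel in force)+

lemma hnorm_square_expand:
  assumes "x \<in> H" "y \<in> H"
  shows "(hnorm (x + y))\<^sup>2 = (hnorm x)\<^sup>2 + 2 * Re (ip x y) + (hnorm y)\<^sup>2"
  using Re_ip_expand[OF assms, of 1] assms ip_nonneg[of "x + y"]
  by (simp add: hnorm_def ip_nonneg carrier_simps)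

lemma bounded_opE:
  assumes "bounded_op T"
  shows "x \<in> H \<Longrightarrow> T x \<in> H" "x \<in> H \<Longrightarrow> y \<in> H \<Longrightarrow> T (x + y) = T x + T y"
    "x \<in> H \<Longrightarrow> T (c *s x) = c *s T x"
  using assms by (auto simp: bounded_op_def)

lemma bounded_op_bound:
  assumes "bounded_op T"
  obtains K where "0 < K" "\<And>x. x \<in> H \<Longrightarrow> hnorm (T x) \<le> K * hnorm x"
proof -
  obtain K where K: "\<And>x. x \<in> H \<Longrightarrow> hnorm (T x) \<le> K * hnorm x"
    using assms unfolding bounded_op_def by blast
  have "hnorm (T x) \<le> max K 1 * hnorm x" if "x \<in> H" for x
    using K[OF that] mult_right_mono[of K "max K 1" "hnorm x"] hnorm_nonneg[OF that] by linarith
  then show ?thesis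
    using that[of "max K 1"] by auto
qed

lemma bounded_op_id: "bounded_op id"
  by (auto simp: bounded_op_def intro: exI[of _ 1])

lemma bounded_op_comp:
  assumes "bounded_op S" "bounded_op T"
  shows "bounded_op (S \<circ> T)"
proof -
  obtain K where K: "0 < K" "\<And>x. x \<in> H \<Longrightarrow> hnorm (S x) \<le> K * hnorm x"
    using bounded_op_bound[OF assms(1)] by blast
  obtain L where L: "0 < L" "\<And>x. x \<in> H \<Longrightarrow> hnorm (T x) \<le> L * hnorm x"
    using bounded_op_bound[OF assms(2)] by blast
  have "hnorm (S (T x)) \<le> (K * L) * hnorm x" if "x \<in> H" for x
  proof -
    have "hnorm (S (T x)) \<le> K * hnorm (T x)"
      by (rule K(2)[OF bounded_opE(1)[OF assms(2) that]])
    also have "\<dots> \<le> K * (L * hnorm x)"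
      using L(2)[OF that] K(1) by (intro mult_left_mono) auto
    finally show ?thesis by (simp add: mult.assoc)
  qed
  then show ?thesis
    using bounded_opE[OF assms(1)] bounded_opE[OF assms(2)] by (auto simp: bounded_op_def)
qed

lemma bounded_op_funpow: "bounded_op T \<Longrightarrow> bounded_op (T ^^ n)"
  by (induction n) (simp_all add: bounded_op_id bounded_op_comp)

lemma hnorm_funpow_le:
  assumes "bounded_op T" "\<And>x. x \<in> H \<Longrightarrow> hnorm (T x) \<le> K * hnorm x" "0 \<le> K" "x \<in> H"
  shows "hnorm ((T ^^ n) x) \<le> K ^ n * hnorm x"
proof (induction n)
  case (Suc n)
  have "hnorm (T ((T ^^ n) x)) \<le> K * hnorm ((T ^^ n) x)"
    using assms bounded_opE(1)[OF bounded_op_funpow] by blast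
  also have "\<dots> \<le> K * (K ^ n * hnorm x)"
    using Suc assms by (intro mult_left_mono)
  finally show ?case by simp
qed simp

end

text \<open>Variational proof. If \<open>\<phi>\<close> is the inner product with z, then |x|^2 - 2
  Re (\<phi> x) equals |x - z|^2 - |z|^2. So z is sought as the minimiser of this functional, and a
  minimising sequence is Cauchy by the parallelogram law.\<close>

lemma (in hilbert_space) riesz_representation:
  assumes add: "\<And>x y. \<lbrakk>x \<in> H; y \<in> H\<rbrakk> \<Longrightarrow> \<phi> (x + y) = \<phi> x + \<phi> y"
    and scale: "\<And>c x. x \<in> H \<Longrightarrow> \<phi> (c *s x) = c * \<phi> x"
    and bound: "\<And>x. x \<in> H \<Longrightarrow> norm (\<phi> x) \<le> K * hnorm x"
  obtains z where "z \<in> H" "\<And>x. x \<in> H \<Longrightarrow> \<phi> x = ip x z"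
proof -
  define q where "q x = (hnorm x)\<^sup>2 - 2 * Re (\<phi> x)" for x
  have Re_le: "Re (\<phi> x) \<le> K * hnorm x" if "x \<in> H" for x
    using bound[OF that] complex_Re_le_cmod[of "\<phi> x"] by linarith
  \<comment> \<open>Completing the square: |x|^2 - 2 K |x| = (|x| - K)^2 - K^2.\<close>
  have lower: "- K\<^sup>2 \<le> q x" if "x \<in> H" for x
    using Re_le[OF that] zero_le_power2[of "hnorm x - K"] by (simp add: q_def power2_diff mult.commute)
  define m where "m = Inf (q ` H)"
  have bdd: "bdd_below (q ` H)"
    using lower by (auto intro!: bdd_belowI2)
  have m_le: "m \<le> q x" if "x \<in> H" for x
    unfolding m_def using that bdd by (intro cInf_lower) auto
  have "\<exists>x\<in>H. q x < m + inverse (real (Suc n))" for n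
  proof -
    have "q ` H \<noteq> {}"
      using carrier_simps(1) by auto
    then show ?thesis
      using cInf_less_iff[of "q ` H" "m + inverse (real (Suc n))"] bdd by (auto simp: m_def)
  qed
  then obtain s where s: "\<And>n. s n \<in> H" "\<And>n. q (s n) < m + inverse (real (Suc n))"
    by metis
  have q_add: "q (x + y) = q x + q y + 2 * Re (ip x y)" if "x \<in> H" "y \<in> H" for x y
    using that by (simp add: q_def hnorm_square_expand add)
  \<comment> \<open>Parallelogram law: the linear part of \<open>q\<close> cancels when q x + q y is
    compared with twice the value at the midpoint, and the latter value is at least
    \<open>m\<close>.\<close>
  have half: "(hnorm (x - y))\<^sup>2 \<le> 2 * (q x + q y - 2 * m)" if "x \<in> H" "y \<in> H" for x y
  proof -
    let ?u = "of_real (1/2) *s (x + y)"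
    have u: "?u \<in> H" using that by (simp add: carrier_simps)
    have "hnorm ?u = hnorm (x + y) / 2"
      using that by (subst hnorm_scale) (auto simp: carrier_simps norm_divide)
    moreover have "\<phi> ?u = (\<phi> x + \<phi> y) / 2"
      using that by (subst scale) (auto simp: carrier_simps add)
    ultimately have "q ?u = (hnorm (x + y))\<^sup>2 / 4 - Re (\<phi> x) - Re (\<phi> y)"
      unfolding q_def by (simp only:) (simp add: power_divide add_divide_distrib)
    moreover have "(hnorm (x - y))\<^sup>2 = (hnorm x)\<^sup>2 - 2 * Re (ip x y) + (hnorm y)\<^sup>2"
      using Re_ip_expand[OF that, of "-1"] that ip_nonneg[of "x - y"]
      by (simp add: hnorm_def ip_nonneg carrier_simps)
    ultimately show ?thesis
      using m_le[OF u] hnorm_square_expand[OF that] unfolding q_def by (simp add: field_simps)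
  qed
  have "MCauchy s"
    unfolding MCauchy_def
  proof (intro conjI allI impI)
    fix e :: real assume e: "0 < e"
    \<comment> \<open>Two values within e^2/4 of the infimum give a squared distance below e^2 by
      \<open>half\<close>.\<close>
    obtain N where N: "inverse (real (Suc N)) < e\<^sup>2 / 4"
      using reals_Archimedean[of "e\<^sup>2 / 4"] e by auto
    have "hdist (s n) (s n') < e" if "N \<le> n" "N \<le> n'" for n n'
    proof -
      have "inverse (real (Suc k)) < e\<^sup>2 / 4" if "N \<le> k" for k
        using that N le_imp_inverse_le[of "real (Suc N)" "real (Suc k)"]
        by linarith
      then have "q (s k) < m + e\<^sup>2 / 4" if "N \<le> k" for k
        using s(2)[of k] that by (meson add_strict_left_mono order_less_trans)
      from this[OF that(1)] this[OF that(2)] have "(hnorm (s n - s n'))\<^sup>2 < e\<^sup>2"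
        using half[OF s(1) s(1), of n n'] by argo
      then show ?thesis
        using e s(1) power_less_imp_less_base[of "hnorm (s n - s n')" 2 e] by (simp add: hdist_def)
    qed
    then show "\<exists>N. \<forall>n n'. N \<le> n \<longrightarrow> N \<le> n' \<longrightarrow> hdist (s n) (s n') < e"
      by blast
  qed (use s in auto)
  then obtain z where z: "limitin mtopology s z sequentially"
    using complete by (auto simp: mcomplete_def)
  have zH: "z \<in> H"
    using z by (simp add: limitin_metric)
  have lim0: "(\<lambda>n. hnorm (s n - z)) \<longlonglongrightarrow> 0"
  proof (rule metric_LIMSEQ_I)
    fix e :: real assume "0 < e"
    then obtain N where "\<And>n. n \<ge> N \<Longrightarrow> hdist (s n) z < e"
      using z unfolding limitin_metric eventually_sequentially by blast
    then show "\<exists>N. \<forall>n\<ge>N. dist (hnorm (s n - z)) 0 < e"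
      using s(1) zH by (auto simp: hdist_def hnorm_nonneg carrier_simps intro!: exI[of _ N])
  qed
  \<comment> \<open>The infimum is attained: \<open>q\<close> is expanded around \<open>s n\<close>,
    and the error terms vanish with |s n - z|.\<close>
  have "q z \<le> m"
  proof (rule LIMSEQ_le_const)
    have split: "q z = q (s n) + q (z - s n) + 2 * Re (ip (s n) (z - s n))" for n
      using q_add[of "s n" "z - s n"] s(1)[of n] zH by (simp add: carrier_simps)
    have est: "q z \<le> m + inverse (real (Suc n)) + (hnorm (s n - z))\<^sup>2 + 2 * K * hnorm (s n - z)
        + 2 * (hnorm (s n - z) + hnorm z) * hnorm (s n - z)" for n
    proof -
      let ?h = "z - s n"
      have h: "?h \<in> H" "hnorm ?h = hnorm (s n - z)"
        using s(1) zH by (auto simp: carrier_simps hnorm_minus_commute)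
      have "- Re (\<phi> ?h) \<le> norm (\<phi> ?h)"
        using abs_Re_le_cmod[of "\<phi> ?h"] by linarith
      then have 1: "q ?h \<le> (hnorm (s n - z))\<^sup>2 + 2 * K * hnorm (s n - z)"
        using bound[OF h(1)] h(2) by (simp add: q_def)
      have "hnorm (s n) \<le> hnorm (s n - z) + hnorm z"
        using hnorm_triangle[of "s n - z" z] s(1) zH by (simp add: carrier_simps)
      then have "Re (ip (s n) ?h) \<le> (hnorm (s n - z) + hnorm z) * hnorm (s n - z)"
        using Re_ip_le[OF s(1) h(1)] h(2) hnorm_nonneg[OF h(1)]
        by (smt (verit) mult_right_mono)
      then show ?thesis
        using split[of n] 1 s(2)[of n] by linarith
    qed
    have "(\<lambda>n. m + inverse (real (Suc n)) + (hnorm (s n - z))\<^sup>2 + 2 * K * hnorm (s n - z)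
        + 2 * (hnorm (s n - z) + hnorm z) * hnorm (s n - z)) \<longlonglongrightarrow>
        m + 0 + 0\<^sup>2 + 2 * K * 0 + 2 * (0 + hnorm z) * 0"
      by (intro tendsto_add tendsto_mult tendsto_power tendsto_const lim0 LIMSEQ_inverse_real_of_nat)
    then show "(\<lambda>n. m + inverse (real (Suc n)) + (hnorm (s n - z))\<^sup>2 + 2 * K * hnorm (s n - z)
        + 2 * (hnorm (s n - z) + hnorm z) * hnorm (s n - z)) \<longlonglongrightarrow> m"
      by simp
    show "\<exists>N. \<forall>n\<ge>N. q z \<le> m + inverse (real (Suc n)) + (hnorm (s n - z))\<^sup>2 + 2 * K * hnorm (s n - z)
        + 2 * (hnorm (s n - z) + hnorm z) * hnorm (s n - z)"
      using est by blast
  qed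
  have Re_eq: "Re (\<phi> x) = Re (ip x z)" if x: "x \<in> H" for x
  proof (rule ccontr)
    let ?d = "Re (ip x z) - Re (\<phi> x)"
    assume "Re (\<phi> x) \<noteq> Re (ip x z)"
    then have d: "?d \<noteq> 0" by simp
    \<comment> \<open>Moving the minimiser along \<open>x\<close> cannot decrease \<open>q\<close>,
      whereas a nonzero \<open>?d\<close> would allow this for small \<open>t\<close> of the right
      sign.\<close>
    have "0 \<le> 2 * t * ?d + t\<^sup>2 * (hnorm x)\<^sup>2" for t
    proof -
      let ?t = "complex_of_real t"
      have "m \<le> q (z + ?t *s x)"
        using zH x by (intro m_le) (simp add: carrier_simps)
      also have "\<dots> = q z + 2 * t * ?d + t\<^sup>2 * (hnorm x)\<^sup>2"
        using zH x Re_ip_expand[OF zH x, of t]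
        by (simp add: q_def carrier_simps add scale hnorm_power2 Re_ip_commute[of z x] algebra_simps)
      finally show ?thesis
        using \<open>q z \<le> m\<close> by linarith
    qed
    note pos = this
    \<comment> \<open>The optimal t would be -d / |x|^2; the added 1 covers x = 0 and still gives a
      negative value.\<close>
    let ?B = "(hnorm x)\<^sup>2 + 1"
    have B: "?B > 0" by (simp add: add_nonneg_pos)
    have "0 \<le> 2 * (- ?d / ?B) * ?d + (- ?d / ?B)\<^sup>2 * (hnorm x)\<^sup>2"
      by (rule pos)
    also have "\<dots> \<le> 2 * (- ?d / ?B) * ?d + (- ?d / ?B)\<^sup>2 * ?B"
      by (intro add_left_mono mult_left_mono) auto
    also have "\<dots> = - (?d\<^sup>2 / ?B)"
      using B by (simp add: power2_eq_square divide_simps) (simp add: algebra_simps)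
    also have "\<dots> < 0"
      using d B by simp
    finally show False by simp
  qed
  have "\<phi> x = ip x z" if x: "x \<in> H" for x
  proof (rule complex_eqI)
    show "Re (\<phi> x) = Re (ip x z)" by (rule Re_eq[OF x])
    have "Re (\<phi> (\<i> *s x)) = Re (ip (\<i> *s x) z)"
      using x by (intro Re_eq) (simp add: carrier_simps)
    then show "Im (\<phi> x) = Im (ip x z)"
      using x zH by (simp add: scale ip_scale_left)
  qed
  then show ?thesis
    using that zH by blast
qed

text \<open>Pairing T x with a fixed y is a bounded functional of x, so the Riesz representation
  supplies the vector that the definite description in \<open>hadjoint\<close> names.\<close>

lemma (in hilbert_space) hadjoint:
  assumes "bounded_op T" "y \<in> H"
  shows "hadjoint T y \<in> H" "x \<in> H \<Longrightarrow> ip (T x) y = ip x (hadjoint T y)"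
proof -
  obtain K where K: "0 < K" "\<And>x. x \<in> H \<Longrightarrow> hnorm (T x) \<le> K * hnorm x"
    using bounded_op_bound[OF assms(1)] by blast
  note T = bounded_opE[OF assms(1)]
  obtain z where z: "z \<in> H" "\<And>x. x \<in> H \<Longrightarrow> ip (T x) y = ip x z"
  proof (rule riesz_representation[of "\<lambda>x. ip (T x) y" "K * hnorm y"])
    show "norm (ip (T x) y) \<le> K * hnorm y * hnorm x" if "x \<in> H" for x
      using norm_ip_le[OF T(1)[OF that] assms(2)] mult_right_mono[OF K(2)[OF that] hnorm_nonneg[OF assms(2)]]
      by (simp add: mult_ac)
  qed (use T assms in \<open>auto simp: ip_add_left ip_scale_left\<close>)
  have "hadjoint T y = z"
    by (rule hadjoint_eqI) (use assms z in auto)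
  then show "hadjoint T y \<in> H" "x \<in> H \<Longrightarrow> ip (T x) y = ip x (hadjoint T y)"
    using z by auto
qed

section \<open>Powers of a commuting tuple\<close>

definition list_power :: "'n list \<Rightarrow> ('n \<Rightarrow> 'a \<Rightarrow> 'a) \<Rightarrow> ('n \<Rightarrow>\<^sub>0 nat) \<Rightarrow> 'a \<Rightarrow> 'a"
  where "list_power is T \<alpha> = foldr (\<lambda>i S. (T i ^^ Poly_Mapping.lookup \<alpha> i) \<circ> S) is id"

lemma list_power_Nil [simp]: "list_power [] T \<alpha> x = x"
  by (simp add: list_power_def)

lemma list_power_Cons [simp]:
  "list_power (i # is) T \<alpha> x = (T i ^^ Poly_Mapping.lookup \<alpha> i) (list_power is T \<alpha> x)"
  by (simp add: list_power_def)

text \<open>\<open>tuple_power\<close> multiplies along an enumeration fixed by choice. Facts about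
  it are proved by induction for products along arbitrary lists and then specialised.\<close>

lemma tuple_power_list_power:
  obtains "is" :: "'n::finite list" where "distinct is" "set is = UNIV"
    "tuple_power = (list_power is :: ('n \<Rightarrow> 'a \<Rightarrow> 'a) \<Rightarrow> _)"
proof
  let ?is = "SOME is. distinct is \<and> set is = (UNIV :: 'n set)"
  have "\<exists>is. distinct is \<and> set is = (UNIV :: 'n set)"
    using finite_distinct_list[of "UNIV :: 'n set"] by auto
  then have "distinct ?is \<and> set ?is = UNIV"
    by (rule someI_ex)
  then show "distinct ?is" "set ?is = UNIV" by auto
  show "tuple_power = (list_power ?is :: ('n \<Rightarrow> 'a \<Rightarrow> 'a) \<Rightarrow> _)"
    by (intro ext) (simp add: tuple_power_def list_power_def)
qed

lemma tuple_power_0: "tuple_power T 0 x = x"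
proof -
  have "list_power is T 0 x = x" for "is"
    by (induction "is") auto
  then show ?thesis
    using tuple_power_list_power by metis
qed

lemma tuple_power_single: "tuple_power T (Poly_Mapping.single i m) x = (T i ^^ m) x"
proof -
  have *: "list_power is T (Poly_Mapping.single i m) x = (if i \<in> set is then (T i ^^ m) x else x)"
    if "distinct is" for "is"
    using that by (induction "is") (auto simp: lookup_single when_def)
  show ?thesis
    using * tuple_power_list_power by (metis UNIV_I)
qed

context complex_inner_space
begin

lemma tuple_power_bounded_op:
  assumes "commuting_tuple T"
  shows "bounded_op (tuple_power T \<alpha>)"
proof -
  have "bounded_op (T i)" for i
    using assms by (simp add: commuting_tuple_def)
  then have "bounded_op (list_power is T \<alpha>)" for "is"
    unfolding list_power_def
    by (induction "is") (auto simp: bounded_op_id intro!: bounded_op_comp bounded_op_funpow)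
  then show ?thesis
    using tuple_power_list_power by metis
qed

text \<open>The operators commute only on \<open>H\<close>, so membership of the partial products in
  \<open>H\<close> accompanies the exchange of factors.\<close>

lemma list_power_commutes:
  assumes "commuting_tuple T" "x \<in> H"
  shows "list_power is T \<alpha> x \<in> H"
    and "(T i ^^ m) (list_power is T \<alpha> x) = list_power is T \<alpha> ((T i ^^ m) x)"
proof -
  have b: "bounded_op (T i ^^ m)" for i m
    using assms by (auto simp: commuting_tuple_def intro: bounded_op_funpow)
  note cl = bounded_opE(1)[OF b]
  have comm: "T i (T j y) = T j (T i y)" if "y \<in> H" for i j y
    using that assms by (auto simp: commuting_tuple_def)
  have c1: "T i ((T j ^^ m) y) = (T j ^^ m) (T i y)" if "y \<in> H" for i j m y
  proof (induction m)
    case (Suc m)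
    then show ?case
      using comm[of "(T j ^^ m) y" i j] cl[OF that] by (simp only: funpow.simps o_apply)
  qed simp
  have Ti: "T i y \<in> H" if "y \<in> H" for i y
    using assms(1) that bounded_opE(1) unfolding commuting_tuple_def by blast
  have c2: "(T i ^^ n) ((T j ^^ m) y) = (T j ^^ m) ((T i ^^ n) y)" if "y \<in> H" for i j m n y
  proof (induction n)
    case (Suc n)
    then show ?case
      using c1[OF cl[OF that]] by simp
  qed simp
  show m: "list_power is T \<alpha> x \<in> H" for "is"
    by (induction "is") (auto simp: cl assms(2))
  show "(T i ^^ m) (list_power is T \<alpha> x) = list_power is T \<alpha> ((T i ^^ m) x)"
  proof (induction "is")
    case (Cons j "is")
    then show ?case
      by (metis c2[OF m] list_power_Cons)
  qed simp
qed

lemma tuple_power_add: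
  assumes "commuting_tuple T" "x \<in> H"
  shows "tuple_power T (\<alpha> + \<beta>) x = tuple_power T \<alpha> (tuple_power T \<beta> x)"
proof -
  have "list_power is T (\<alpha> + \<beta>) x = list_power is T \<alpha> (list_power is T \<beta> x)" for "is"
    by (induction "is")
      (simp_all add: lookup_add funpow_add list_power_commutes(2)[OF assms(1)] list_power_commutes(1)[OF assms])
  then show ?thesis
    using tuple_power_list_power by metis
qed

end

text \<open>Moving the adjoints across reverses the order of the factors, while both sides use the
  same enumeration; \<open>list_power_commutes\<close> for \<open>T\<close> restores the
  order.\<close>

lemma (in hilbert_space) tuple_power_hadjoint:
  assumes "commuting_tuple T" "w \<in> H" "y \<in> H"
  shows "tuple_power (\<lambda>i. hadjoint (T i)) \<beta> w \<in> H"
    and "ip (tuple_power (\<lambda>i. hadjoint (T i)) \<beta> w) y = ip w (tuple_power T \<beta> y)"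
proof -
  let ?A = "\<lambda>i. hadjoint (T i)"
  have b: "bounded_op (T i)" for i
    using assms by (auto simp: commuting_tuple_def)
  have cl: "(T i ^^ m) y \<in> H" if "y \<in> H" for i m y
    using that bounded_opE(1)[OF bounded_op_funpow[OF b]] by blast
  have cl1: "T i y \<in> H" if "y \<in> H" for i y
    using that b bounded_opE(1) by blast
  have Acl: "(?A i ^^ m) v \<in> H" if "v \<in> H" for i m v
    using that by (induction m) (auto simp: hadjoint(1)[OF b])
  have Aip1: "ip (?A i v) y = ip v (T i y)" if "v \<in> H" "y \<in> H" for i v y
    using that hadjoint(1)[of "T i" v] hadjoint(2)[of "T i" v y] b[of i] ip_cnj bounded_opE(1)[of "T i"]
    by metis
  have Aip: "ip ((?A i ^^ m) v) y = ip v ((T i ^^ m) y)" if "v \<in> H" "y \<in> H" for i m v y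
    using that(2)
  proof (induction m arbitrary: y)
    case (Suc m)
    then show ?case
      using that by (simp add: Aip1 Acl cl1 funpow_swap1[of "T i"])
  qed simp
  have "list_power is ?A \<beta> w \<in> H \<and>
      (\<forall>y\<in>H. ip (list_power is ?A \<beta> w) y = ip w (list_power is T \<beta> y))" for "is"
    by (induction "is")
      (use assms in \<open>simp_all add: Acl Aip cl list_power_commutes(2)\<close>)
  then show "tuple_power ?A \<beta> w \<in> H" "ip (tuple_power ?A \<beta> w) y = ip w (tuple_power T \<beta> y)"
    using tuple_power_list_power assms(3) by metis+
qed


section \<open>Polynomial partitions of unity\<close>

abbreviation zmono :: "('n \<Rightarrow>\<^sub>0 nat) \<times> ('n \<Rightarrow>\<^sub>0 nat) \<Rightarrow> 'n zpoly"
  where "zmono k \<equiv> Poly_Mapping.single k 1"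

text \<open>A partition of unity \<theta>_z subordinate to small balls around a finite net
  \<open>Z\<close> freezes the variable point at the net points; \<open>h z\<close> is a nonnegative
  polynomial close to w(z) \<theta>_z. The coefficient of \<open>h z\<close> is a rank-one positive
  matrix in (k, l), which is what reduces matrix inequalities to scalar ones.\<close>

lemma polynomial_partition:
  fixes w :: "'n::finite zpoly"
  assumes S: "finite S" and w: "w \<in> real_polys" "\<And>a. a \<in> polydisc R \<Longrightarrow> 0 \<le> Re (zeval w a)"
    and "0 < e"
  obtains Z h where "finite Z" "\<And>z. z \<in> Z \<Longrightarrow> h z \<in> real_polys"
    "\<And>z a. \<lbrakk>z \<in> Z; a \<in> polydisc R\<rbrakk> \<Longrightarrow> 0 \<le> Re (zeval (h z) a)"
    "\<And>k l a. \<lbrakk>k \<in> S; l \<in> S; a \<in> polydisc R\<rbrakk> \<Longrightarrow>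
       norm (zeval (w * zmono k * star (zmono l)) a -
         (\<Sum>z\<in>Z. mono_eval z k * cnj (mono_eval z l) * zeval (h z) a)) \<le> e"
proof -
  let ?D = "polydisc R :: (complex ^ 'n) set"
  define \<Phi> where "\<Phi> p = zeval (w * zmono (fst p) * star (zmono (snd p)))"
    for p :: "(('n \<Rightarrow>\<^sub>0 nat) \<times> ('n \<Rightarrow>\<^sub>0 nat)) \<times> (('n \<Rightarrow>\<^sub>0 nat) \<times> ('n \<Rightarrow>\<^sub>0 nat))"
  have \<Phi>: "\<Phi> (k, l) a = of_real (Re (zeval w a)) * (mono_eval a k * cnj (mono_eval a l))" for k l a
    using zeval_real_polys[OF w(1), of a]
    by (simp add: \<Phi>_def zeval_mult zeval_single zeval_star)
  define close where "close p d \<longleftrightarrow> (\<forall>a\<in>?D. \<forall>b\<in>?D. dist a b < d \<longrightarrow> dist (\<Phi> p a) (\<Phi> p b) < e / 2)" for p d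
  have "eventually (close p) (at_right 0)" for p
  proof -
    have "uniformly_continuous_on ?D (\<Phi> p)"
      unfolding \<Phi>_def by (intro compact_uniformly_continuous continuous_on_zeval compact_polydisc)
    then obtain d where d: "0 < d" "\<And>a b. \<lbrakk>a \<in> ?D; b \<in> ?D; dist a b < d\<rbrakk> \<Longrightarrow> dist (\<Phi> p a) (\<Phi> p b) < e / 2"
      using \<open>0 < e\<close> unfolding uniformly_continuous_on_def
      by (metis dist_commute half_gt_zero)
    have "close p d'" if "d' \<in> {0<..<d}" for d'
      unfolding close_def using that d(2) by force
    then show ?thesis
      using eventually_at_right_real[OF d(1)] by (auto elim: eventually_mono)
  qed
  \<comment> \<open>One radius has to serve all pairs of monomials: each condition holds for all
    sufficiently small radii, and there are finitely many.\<close>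
  then have "eventually (\<lambda>d. \<forall>p\<in>S \<times> S. close p d) (at_right 0)"
    using S by (intro eventually_ball_finite) auto
  then obtain d where d: "0 < d" "\<And>p. p \<in> S \<times> S \<Longrightarrow> close p d"
    using eventually_happens'[of "at_right (0::real)"
        "\<lambda>d. (\<forall>p\<in>S \<times> S. close p d) \<and> 0 < d"] eventually_at_right_less[of "0::real"]
    by (auto simp: eventually_conj_iff)
  have "?D \<subseteq> (\<Union>z\<in>?D. ball z d)"
    using d(1) by auto
  then obtain Z where Z: "Z \<subseteq> ?D" "finite Z" "?D \<subseteq> (\<Union>z\<in>Z. ball z d)"
    using compactE_image[OF compact_polydisc, of ?D "\<lambda>z. ball z d" R] by blast
  \<comment> \<open>Tent functions supported on the balls; their sum is positive on the polydisc by
    the covering, so dividing by it gives the partition of unity.\<close>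
  define b where "b z a = max 0 (d - dist z a)" for z a :: "complex ^ 'n"
  define B where "B a = (\<Sum>z\<in>Z. b z a)" for a
  have b_nonneg: "0 \<le> b z a" for z a
    by (simp add: b_def)
  have B_pos: "0 < B a" if a: "a \<in> ?D" for a
  proof -
    obtain z where "z \<in> Z" "dist z a < d"
      using Z(3) a by auto
    then show ?thesis
      unfolding B_def by (intro sum_pos2[OF Z(2), of z]) (auto simp: b_def)
  qed
  define \<theta> where "\<theta> z a = b z a / B a" for z a
  have \<theta>_nonneg: "0 \<le> \<theta> z a" if "a \<in> ?D" for z a
    using B_pos[OF that] b_nonneg[of z a] by (simp add: \<theta>_def)
  have \<theta>_sum: "(\<Sum>z\<in>Z. \<theta> z a) = 1" if "a \<in> ?D" for a
    using B_pos[OF that] by (simp add: \<theta>_def B_def flip: sum_divide_distrib)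
  have b_cont: "continuous_on ?D (b z)" for z
    unfolding b_def[abs_def] by (intro continuous_intros)
  have B_cont: "continuous_on ?D B"
    unfolding B_def[abs_def] by (intro continuous_on_sum b_cont)
  have \<theta>_cont: "continuous_on ?D (\<theta> z)" for z
    unfolding \<theta>_def[abs_def]
    by (intro continuous_on_divide b_cont B_cont) (metis B_pos less_irrefl)
  \<comment> \<open>\<open>M\<close> bounds the total size of the coefficients for every pair in
    \<open>S\<close>; \<open>\<eta>\<close> makes the approximation error 2 \<eta> M at most
    e/2.\<close>
  define M where "M = (\<Sum>p\<in>S \<times> S. \<Sum>z\<in>Z. norm (mono_eval z (fst p)) * norm (mono_eval z (snd p)))"
  define \<eta> where "\<eta> = e / (4 * (M + 1))"
  have M: "0 \<le> M"
    unfolding M_def by (intro sum_nonneg) auto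
  then have \<eta>: "0 < \<eta>" "2 * \<eta> * M \<le> e / 2"
    using \<open>0 < e\<close> by (auto simp: \<eta>_def field_simps)
  have "\<exists>h\<in>real_polys. \<forall>a\<in>?D. 0 \<le> Re (zeval h a) \<and>
      norm (zeval h a - of_real (Re (zeval w z) * \<theta> z a)) \<le> 2 * \<eta>" if z: "z \<in> Z" for z
  proof -
    have "continuous_on ?D (\<lambda>a. Re (zeval w z) * \<theta> z a)"
      by (intro continuous_intros \<theta>_cont)
    then obtain g where g: "real_polynomial_function g"
      "\<And>a. a \<in> ?D \<Longrightarrow> \<bar>Re (zeval w z) * \<theta> z a - g a\<bar> < \<eta>"
      using Stone_Weierstrass_real_polynomial_function[OF compact_polydisc _ \<eta>(1)] by blast
    obtain f where f: "f \<in> real_polys" "\<And>a. zeval f a = of_real (g a)"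
      using real_polynomial_function_zpoly[OF g(1)] by blast
    \<comment> \<open>Raising the approximant by \<open>\<eta>\<close> makes it nonnegative on the
      polydisc, at the price of doubling the error.\<close>
    let ?h = "f + const_poly (of_real \<eta>)"
    have "0 \<le> Re (zeval ?h a) \<and> norm (zeval ?h a - of_real (Re (zeval w z) * \<theta> z a)) \<le> 2 * \<eta>"
      if a: "a \<in> ?D" for a
    proof -
      have "0 \<le> Re (zeval w z) * \<theta> z a"
        using w(2) z Z(1) \<theta>_nonneg[OF a] by auto
      moreover have Re: "Re (zeval ?h a) = g a + \<eta>"
        by (simp add: zeval_add zeval_const f)
      moreover have "zeval ?h a - of_real (Re (zeval w z) * \<theta> z a) =
          of_real (g a + \<eta> - Re (zeval w z) * \<theta> z a)"
        by (simp add: zeval_add zeval_const f)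
      then have "norm (zeval ?h a - of_real (Re (zeval w z) * \<theta> z a)) =
          \<bar>g a + \<eta> - Re (zeval w z) * \<theta> z a\<bar>"
        by (simp only: norm_of_real)
      ultimately show ?thesis
        using g(2)[OF a] by linarith
    qed
    moreover have "?h \<in> real_polys"
      by (intro real_polys_add f real_polys_const)
    ultimately show ?thesis by blast
  qed
  then obtain h where h: "\<And>z. z \<in> Z \<Longrightarrow> h z \<in> real_polys"
    "\<And>z a. \<lbrakk>z \<in> Z; a \<in> ?D\<rbrakk> \<Longrightarrow> 0 \<le> Re (zeval (h z) a)"
    "\<And>z a. \<lbrakk>z \<in> Z; a \<in> ?D\<rbrakk> \<Longrightarrow> norm (zeval (h z) a - of_real (Re (zeval w z) * \<theta> z a)) \<le> 2 * \<eta>"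
    by metis
  show ?thesis
  proof (rule that[of Z h])
    fix k l a assume kl: "k \<in> S" "l \<in> S" and a: "a \<in> ?D"
    let ?c = "\<lambda>z. mono_eval z k * cnj (mono_eval z l)"
    \<comment> \<open>Either \<open>a\<close> lies in the ball around \<open>z\<close>, where
      uniform continuity applies, or \<open>\<theta> z a\<close> vanishes.\<close>
    have near: "norm (\<Phi> (k, l) a - \<Phi> (k, l) z) * \<theta> z a \<le> e / 2 * \<theta> z a" if z: "z \<in> Z" for z
    proof (cases "dist z a < d")
      case True
      then have "dist (\<Phi> (k, l) z) (\<Phi> (k, l) a) < e / 2"
        using d(2)[of "(k, l)"] kl a z Z(1) by (auto simp: close_def)
      then show ?thesis
        using \<theta>_nonneg[OF a] by (intro mult_right_mono) (auto simp: dist_norm norm_minus_commute)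
    qed (simp add: \<theta>_def b_def)
    have "\<Phi> (k, l) a = (\<Sum>z\<in>Z. \<Phi> (k, l) a * of_real (\<theta> z a))"
      using \<theta>_sum[OF a] by (simp flip: sum_distrib_left of_real_sum)
    then have "\<Phi> (k, l) a - (\<Sum>z\<in>Z. \<Phi> (k, l) z * of_real (\<theta> z a)) =
        (\<Sum>z\<in>Z. (\<Phi> (k, l) a - \<Phi> (k, l) z) * of_real (\<theta> z a))"
      by (simp add: sum_subtractf left_diff_distrib)
    also have "norm \<dots> \<le> (\<Sum>z\<in>Z. norm (\<Phi> (k, l) a - \<Phi> (k, l) z) * \<theta> z a)"
      using \<theta>_nonneg[OF a] by (intro order_trans[OF norm_sum]) (simp add: norm_mult)
    also have "\<dots> \<le> (\<Sum>z\<in>Z. e / 2 * \<theta> z a)"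
      by (intro sum_mono near)
    also have "\<dots> = e / 2"
      by (simp only: sum_distrib_left[symmetric] \<theta>_sum[OF a] mult_1_right)
    finally have 1: "norm (\<Phi> (k, l) a - (\<Sum>z\<in>Z. \<Phi> (k, l) z * of_real (\<theta> z a))) \<le> e / 2" .
    \<comment> \<open>Second half of the error: the weights w(z) \<theta>_z are replaced by the
      polynomials \<open>h z\<close>.\<close>
    have "(\<Sum>z\<in>Z. \<Phi> (k, l) z * of_real (\<theta> z a)) - (\<Sum>z\<in>Z. ?c z * zeval (h z) a) =
        (\<Sum>z\<in>Z. ?c z * (of_real (Re (zeval w z) * \<theta> z a) - zeval (h z) a))"
      by (simp add: \<Phi> sum_subtractf right_diff_distrib mult_ac)
    also have "norm \<dots> \<le> (\<Sum>z\<in>Z. norm (?c z) * (2 * \<eta>))"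
      using h(3)[OF _ a] by (intro order_trans[OF norm_sum] sum_mono)
        (auto simp: norm_mult norm_minus_commute intro!: mult_left_mono)
    also have "\<dots> = 2 * \<eta> * (\<Sum>z\<in>Z. norm (mono_eval z k) * norm (mono_eval z l))"
      by (simp add: sum_distrib_left norm_mult mult_ac)
    also have "\<dots> \<le> 2 * \<eta> * M"
      unfolding M_def using \<eta>(1) kl S
        member_le_sum[of "(k, l)" "S \<times> S" "\<lambda>p. \<Sum>z\<in>Z. norm (mono_eval z (fst p)) * norm (mono_eval z (snd p))"]
      by (intro mult_left_mono) (auto simp: sum_nonneg)
    finally have 2: "norm ((\<Sum>z\<in>Z. \<Phi> (k, l) z * of_real (\<theta> z a)) - (\<Sum>z\<in>Z. ?c z * zeval (h z) a)) \<le> e / 2"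
      using \<eta>(2) by linarith
    have "norm (\<Phi> (k, l) a - (\<Sum>z\<in>Z. ?c z * zeval (h z) a)) \<le> e / 2 + e / 2"
      using norm_triangle_mono[OF 1 2] by simp
    then show "norm (zeval (w * zmono k * star (zmono l)) a -
         (\<Sum>z\<in>Z. mono_eval z k * cnj (mono_eval z l) * zeval (h z) a)) \<le> e"
      by (simp add: \<Phi>_def)
  qed (use Z h in auto)
qed

section \<open>The sesquilinear form of the hereditary calculus\<close>

text \<open>Tensors are written as lists of elementary tensors, so a sesquilinear form on them is a
  double sum over lists.\<close>

definition list_form :: "('p \<Rightarrow> 'q \<Rightarrow> complex) \<Rightarrow> 'p list \<Rightarrow> 'q list \<Rightarrow> complex"
  where "list_form B u v = (\<Sum>p\<leftarrow>u. \<Sum>q\<leftarrow>v. B p q)"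

lemma list_form_cong:
  "(\<And>p q. p \<in> set u \<Longrightarrow> q \<in> set v \<Longrightarrow> B p q = C p q) \<Longrightarrow> list_form B u v = list_form C u v"
  unfolding list_form_def by (intro arg_cong[of _ _ sum_list] map_cong refl) auto

lemma list_form_add: "list_form (\<lambda>p q. B p q + C p q) u v = list_form B u v + list_form C u v"
  by (simp add: list_form_def sum_list_addf)

lemma list_form_sum: "list_form (\<lambda>p q. \<Sum>z\<in>Z. B z p q) u v = (\<Sum>z\<in>Z. list_form (B z) u v)"
  by (induction Z rule: infinite_finite_induct) (simp_all add: list_form_def list_form_add[unfolded list_form_def])

lemma norm_list_form_le:
  assumes "\<And>p q. p \<in> set u \<Longrightarrow> q \<in> set v \<Longrightarrow> norm (B p q) \<le> C p q"
  shows "norm (list_form B u v) \<le> (\<Sum>p\<leftarrow>u. \<Sum>q\<leftarrow>v. C p q)"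
proof -
  have *: "norm (\<Sum>q\<leftarrow>v. f q) \<le> (\<Sum>q\<leftarrow>v. g q)" if "\<And>q. q \<in> set v \<Longrightarrow> norm (f q) \<le> g q"
    for f :: "'c \<Rightarrow> complex" and g v
    using that
  proof (induction v)
    case (Cons q v)
    then show ?case
      using norm_triangle_mono[of "f q" "g q"] by simp
  qed simp
  show ?thesis
    unfolding list_form_def using assms by (intro *) auto
qed

lemma list_form_append_left: "list_form B (u @ u') v = list_form B u v + list_form B u' v"
  by (simp add: list_form_def)

locale hilbert_tuple = hilbert_space +
  fixes T :: "'n::finite \<Rightarrow> 'a \<Rightarrow> 'a"
  assumes commuting: "commuting_tuple T"
begin

abbreviation pow :: "('n \<Rightarrow>\<^sub>0 nat) \<Rightarrow> 'a \<Rightarrow> 'a"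
  where "pow \<equiv> tuple_power T"

lemmas pow_bounded = tuple_power_bounded_op[OF commuting]
lemmas pow_simps = bounded_opE[OF pow_bounded]

text \<open>The inner product of the hereditary value of f at x with y. As all adjoints stand on the
  left, they reappear in the second argument as powers of \<open>T\<close>.\<close>

definition hform :: "'n zpoly \<Rightarrow> 'a \<Rightarrow> 'a \<Rightarrow> complex"
  where "hform f x y = lin_ext (\<lambda>k. ip (pow (fst k) x) (pow (snd k) y)) f"

lemma ip_hereditary:
  assumes "x \<in> H" "y \<in> H"
  shows "ip (hereditary f T x) y = hform f x y"
proof -
  let ?A = "\<lambda>\<beta>. tuple_power (\<lambda>i. hadjoint (T i)) \<beta>"
  have H: "?A \<beta> (pow \<alpha> x) \<in> H" for \<alpha> \<beta>
    using assms by (intro tuple_power_hadjoint[OF commuting]) (auto simp: pow_simps)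
  have "ip (hereditary f T x) y =
      (\<Sum>k\<in>Poly_Mapping.keys f. Poly_Mapping.lookup f k * ip (?A (snd k) (pow (fst k) x)) y)"
    unfolding hereditary_def case_prod_beta
    by (subst ip_sum_left) (use assms H in \<open>auto simp: carrier_simps ip_scale_left\<close>)
  then show ?thesis
    using assms by (simp add: hform_def lin_ext_def tuple_power_hadjoint[OF commuting] pow_simps)
qed

lemma hform_add: "hform (f + g) x y = hform f x y + hform g x y"
  by (simp add: hform_def lin_ext_add)

lemma hform_diff: "hform (f - g) x y = hform f x y - hform g x y"
  by (simp add: hform_def lin_ext_diff)

lemma hform_sum: "hform (\<Sum>i\<in>A. f i) x y = (\<Sum>i\<in>A. hform (f i) x y)"
  by (simp add: hform_def lin_ext_sum)

lemma hform_const_mult: "hform (const_poly c * f) x y = c * hform f x y"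
  by (simp add: hform_def lin_ext_const_mult)

lemma hform_single: "hform (Poly_Mapping.single k c) x y = c * ip (pow (fst k) x) (pow (snd k) y)"
  by (simp add: hform_def lin_ext_single)

lemma hform_const: "hform (const_poly c) x y = c * ip x y"
  by (simp add: hform_single tuple_power_0)

lemma hform_add_left: "\<lbrakk>x \<in> H; x' \<in> H; y \<in> H\<rbrakk> \<Longrightarrow> hform f (x + x') y = hform f x y + hform f x' y"
  by (simp add: hform_def lin_ext_def pow_simps ip_add_left distrib_left sum.distrib)

lemma hform_scale_left: "\<lbrakk>x \<in> H; y \<in> H\<rbrakk> \<Longrightarrow> hform f (c *s x) y = c * hform f x y"
  by (simp add: hform_def lin_ext_def pow_simps ip_scale_left sum_distrib_left mult_ac)

lemma hform_add_right: "\<lbrakk>x \<in> H; x' \<in> H; y \<in> H\<rbrakk> \<Longrightarrow> hform f y (x + x') = hform f y x + hform f y x'"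
  by (simp add: hform_def lin_ext_def pow_simps ip_add_right distrib_left sum.distrib)

lemma hform_scale_right: "\<lbrakk>x \<in> H; y \<in> H\<rbrakk> \<Longrightarrow> hform f y (c *s x) = cnj c * hform f y x"
  by (simp add: hform_def lin_ext_def pow_simps ip_scale_right sum_distrib_left mult_ac)

lemma hform_star: "\<lbrakk>x \<in> H; y \<in> H\<rbrakk> \<Longrightarrow> hform (star f) x y = cnj (hform f y x)"
proof (induction f rule: poly_mapping_induct)
  case (single k c)
  then show ?case
    using ip_cnj[of "pow (snd k) x" "pow (fst k) y"]
    by (cases k) (simp add: star_single hform_single pow_simps)
qed (simp add: star_add hform_add)

lemma hform_real_polys:
  assumes "f \<in> real_polys" "x \<in> H"
  shows "hform f x x = of_real (Re (hform f x x))"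
  using hform_star[OF assms(2) assms(2), of f] assms by (simp add: real_polys_def complex_eq_iff)

lemma hform_combination_left:
  assumes "y \<in> H" "\<And>p. p \<in> set u \<Longrightarrow> g p \<in> H"
  shows "(\<Sum>p\<leftarrow>u. c p *s g p) \<in> H \<and>
    hform f (\<Sum>p\<leftarrow>u. c p *s g p) y = (\<Sum>p\<leftarrow>u. c p * hform f (g p) y)"
  using assms(2)
proof (induction u)
  case Nil
  then show ?case
    using hform_scale_left[of 0 y f 0] assms(1) by (simp add: carrier_simps)
qed (use assms in \<open>simp add: carrier_simps hform_add_left hform_scale_left\<close>)

lemma hform_combination_right:
  assumes "y \<in> H" "\<And>p. p \<in> set u \<Longrightarrow> g p \<in> H"
  shows "hform f y (\<Sum>p\<leftarrow>u. c p *s g p) = (\<Sum>p\<leftarrow>u. cnj (c p) * hform f y (g p))"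
proof -
  have "hform f y (\<Sum>p\<leftarrow>u. c p *s g p) = cnj (hform (star f) (\<Sum>p\<leftarrow>u. c p *s g p) y)"
    using hform_combination_left[OF assms, where c = c and f = "star f"] assms
    by (simp add: hform_star)
  also have "\<dots> = (\<Sum>p\<leftarrow>u. cnj (c p * hform (star f) (g p) y))"
    using hform_combination_left[OF assms, where c = c and f = "star f"] assms(2)
    by (simp add: o_def) (induction u; simp)
  also have "\<dots> = (\<Sum>p\<leftarrow>u. cnj (c p) * hform f y (g p))"
    using assms by (intro arg_cong[of _ _ sum_list] map_cong refl) (simp add: hform_star)
  finally show ?thesis .
qed

text \<open>For holomorphic p the operator attached to \<open>p * star p\<close> is the adjoint of
  p(T) times p(T), so the value is the squared norm of X = p(T) x.\<close>

lemma hform_holo_mult_star: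
  assumes "p \<in> holo_polys" "x \<in> H"
  shows "0 \<le> Re (hform (p * star p) x x)"
proof -
  define X where "X = (\<Sum>k\<in>Poly_Mapping.keys p. Poly_Mapping.lookup p k *s pow (fst k) x)"
  have XH: "X \<in> H"
    using assms(2) by (auto simp: X_def carrier_simps pow_simps)
  have key: "snd k = 0" if "k \<in> Poly_Mapping.keys p" for k
    using assms(1) that by (auto simp: holo_polys_def case_prod_beta)
  have "p * star p = (\<Sum>k\<in>Poly_Mapping.keys p. Poly_Mapping.single k (Poly_Mapping.lookup p k)) *
      star (\<Sum>k\<in>Poly_Mapping.keys p. Poly_Mapping.single k (Poly_Mapping.lookup p k))"
    by (simp only: poly_mapping_sum_single)
  also have "\<dots> = (\<Sum>k\<in>Poly_Mapping.keys p. \<Sum>l\<in>Poly_Mapping.keys p.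
      Poly_Mapping.single (fst k, fst l) (Poly_Mapping.lookup p k * cnj (Poly_Mapping.lookup p l)))"
  proof -
    have "Poly_Mapping.single k (Poly_Mapping.lookup p k) * star (Poly_Mapping.single l (Poly_Mapping.lookup p l)) =
       Poly_Mapping.single (fst k, fst l) (Poly_Mapping.lookup p k * cnj (Poly_Mapping.lookup p l))"
      if "k \<in> Poly_Mapping.keys p" "l \<in> Poly_Mapping.keys p" for k l
      using key[OF that(1)] key[OF that(2)] by (cases k; cases l) (simp add: star_single mult_single)
    then show ?thesis
      by (simp add: star_sum sum_product)
  qed
  finally have "hform (p * star p) x x = (\<Sum>k\<in>Poly_Mapping.keys p. \<Sum>l\<in>Poly_Mapping.keys p.
      (Poly_Mapping.lookup p k * cnj (Poly_Mapping.lookup p l)) * ip (pow (fst k) x) (pow (fst l) x))"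
    by (simp add: hform_sum hform_single)
  also have "\<dots> = ip X X"
    using assms(2) XH
    by (subst (2) X_def, subst ip_sum_right)
       (auto simp: X_def carrier_simps pow_simps ip_sum_left ip_scale_left ip_scale_right
          sum_distrib_left mult_ac intro: sum.swap)
  finally show ?thesis
    using ip_nonneg[OF XH] by simp
qed

text \<open>The polynomials with nonnegative value at \<open>x\<close> form a convex cone that
  contains the generators, hence also their hull.\<close>

lemma hform_hermitian_sos:
  assumes "f \<in> hermitian_sos" "x \<in> H"
  shows "0 \<le> Re (hform f x x)"
proof -
  have "convex_cone {f. 0 \<le> Re (hform f x x)}"
    by (auto simp: convex_cone_iff hform_add scaleR_eq_const_mult hform_const_mult)
       (simp add: hform_def lin_ext_0)
  moreover have "{p * star p | p. p \<in> holo_polys} \<subseteq> {f. 0 \<le> Re (hform f x x)}"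
    using assms hform_holo_mult_star by auto
  ultimately show ?thesis
    using assms(1) hull_minimal[of _ "{f. 0 \<le> Re (hform f x x)}" convex_cone]
    unfolding hermitian_sos_def by blast
qed

text \<open>Positivity on all of \<complex>^n includes positivity on \<open>real_zeros I\<close>; in
  the decomposition given by (Q) the ideal part contributes 0.\<close>

lemma quillen_imp_hform_nonneg:
  assumes "quillen_property I" "\<And>p x. p \<in> I \<Longrightarrow> x \<in> H \<Longrightarrow> hereditary p T x = 0"
    and "f \<in> real_polys" "\<And>a. 0 < Re (zeval f a)" "x \<in> H"
  shows "0 \<le> Re (hform f x x)"
proof -
  obtain s g where "s \<in> hermitian_sos" "g \<in> I" "f = s + g"
    using assms by (auto simp: quillen_property_def)
  moreover have "hform g x x = 0"
    using assms(2)[OF \<open>g \<in> I\<close> assms(5)] ip_hereditary[OF assms(5) assms(5), of g] assms(5)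
    by (simp add: ip_zero)
  ultimately show ?thesis
    using hform_hermitian_sos assms(5) by (simp add: hform_add)
qed

end


section \<open>Positivity of the hereditary calculus\<close>

lemma mono_eval_diag:
  "mono_eval a (Poly_Mapping.single i m, Poly_Mapping.single i m) = of_real (norm (a $ i) ^ (2 * m))"
proof -
  have "(\<Prod>j\<in>UNIV. f j ^ Poly_Mapping.lookup (Poly_Mapping.single i m) j) = f i ^ m" for f :: "'a \<Rightarrow> complex"
  proof -
    have "(\<Prod>j\<in>UNIV. f j ^ Poly_Mapping.lookup (Poly_Mapping.single i m) j) =
        (\<Prod>j\<in>UNIV. if j = i then f i ^ m else 1)"
      by (rule prod.cong) (auto simp: lookup_single)
    then show ?thesis by simp
  qed
  then have "mono_eval a (Poly_Mapping.single i m, Poly_Mapping.single i m) = (a $ i) ^ m * cnj (a $ i) ^ m"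
    by (simp only: mono_eval_def fst_conv snd_conv)
  also have "\<dots> = (of_real ((norm (a $ i))\<^sup>2)) ^ m"
    by (simp only: complex_norm_square power_mult_distrib)
  also have "\<dots> = of_real (norm (a $ i) ^ (2 * m))"
    by (simp only: power_mult of_real_power)
  finally show ?thesis .
qed

text \<open>All that is kept of the ideal is positivity for everywhere positive polynomials.
  \<open>K\<close> bounds all operators at once, and the gap \<open>K < R\<close> drives the limit
  argument.\<close>

locale positive_tuple = hilbert_tuple scale H ip T
  for scale :: "complex \<Rightarrow> 'a::ab_group_add \<Rightarrow> 'a" (infixr "*s" 75) and H ip
    and T :: "'n::finite \<Rightarrow> 'a \<Rightarrow> 'a" +
  fixes K R :: real
  assumes positive: "\<lbrakk>f \<in> real_polys; \<And>a. 0 < Re (zeval f a); x \<in> H\<rbrakk> \<Longrightarrow> 0 \<le> Re (hform f x x)"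
    and norm_bound: "x \<in> H \<Longrightarrow> hnorm (T i x) \<le> K * hnorm x"
    and K_less_R: "0 \<le> K" "K < R"
begin

text \<open>Outside the polydisc, \<open>f\<close> is dominated by a multiple of \<open>\<Sum>\<^sub>i \<bar>z\<^sub>i / R\<bar>\<^bsup>2k\<^esup>\<close>, and the value of the
  hereditary calculus on this polynomial tends to \<open>0\<close> as \<open>k\<close> grows.\<close>

lemma hform_nonneg:
  assumes f: "f \<in> real_polys" "\<And>a. a \<in> polydisc R \<Longrightarrow> 0 \<le> Re (zeval f a)" and x: "x \<in> H"
  shows "0 \<le> Re (hform f x x)"
proof -
  have R: "0 < R"
    using K_less_R by linarith
  obtain C d where C: "0 \<le> C" "\<And>a t. \<lbrakk>1 \<le> t; a \<in> polydisc (R * t)\<rbrakk> \<Longrightarrow> norm (zeval f a) \<le> C * t ^ d"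
    using zeval_growth[OF R] by blast
  let ?m = "\<lambda>k i. (Poly_Mapping.single i k, Poly_Mapping.single i k) :: ('n \<Rightarrow>\<^sub>0 nat) \<times> ('n \<Rightarrow>\<^sub>0 nat)"
  \<comment> \<open>Chosen so that c_k |a_i|^(2k) = C (|a_i| / R)^(2k), which dominates the growth
    bound C t^d at scale t once k \<ge> d. The term 1/(k + 1) in \<open>g\<close> makes positivity
    strict.\<close>
  define c where "c k = C / R ^ (2 * k)" for k :: nat
  define g where "g k = f + (\<Sum>i\<in>UNIV. Poly_Mapping.single (?m k i) (of_real (c k))) +
    const_poly (of_real (inverse (real (Suc k))))" for k
  define N where "N = real CARD('n)"
  let ?b = "\<lambda>k. - (N * C * ((K / R) ^ 2) ^ k + inverse (real (Suc k))) * (hnorm x)\<^sup>2"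
  have est: "?b k \<le> Re (hform f x x)" if k: "d \<le> k" for k
  proof -
    have zg: "Re (zeval (g k) a) =
        Re (zeval f a) + C * (\<Sum>i\<in>UNIV. (norm (a $ i) / R) ^ (2 * k)) + inverse (real (Suc k))" for a
      by (simp add: g_def zeval_add zeval_const zeval_sum zeval_single mono_eval_diag mono_eval_0
          c_def power_divide sum_distrib_left del: of_nat_Suc of_real_inverse of_real_power)
    have "0 < Re (zeval (g k) a)" for a
    proof (cases "a \<in> polydisc R")
      case True
      have "0 \<le> C * (\<Sum>i\<in>UNIV. (norm (a $ i) / R) ^ (2 * k))"
        using C(1) R by (intro mult_nonneg_nonneg sum_nonneg) auto
      moreover have "0 < inverse (real (Suc k))"
        by simp
      ultimately show ?thesis
        using f(2)[OF True] unfolding zg by linarith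
    next
      case False
      \<comment> \<open>The least scale whose polydisc contains \<open>a\<close>. It exceeds 1 here
        and is attained at a coordinate, so t^(2k) is one of the summands.\<close>
      define t where "t = Max (range (\<lambda>i. norm (a $ i) / R))"
      have t_ge: "norm (a $ i) / R \<le> t" for i
        unfolding t_def by (intro Max_ge) auto
      have "t \<in> range (\<lambda>i. norm (a $ i) / R)"
        unfolding t_def by (intro Max_in) auto
      then obtain j where j: "t = norm (a $ j) / R"
        by blast
      obtain i where "R < norm (a $ i)"
        using False by (auto simp: polydisc_def not_le)
      then have t1: "1 \<le> t"
        using t_ge[of i] R by (simp add: field_simps) (smt (verit) mult_le_cancel_left1)
      have "a \<in> polydisc (R * t)"
        using t_ge R by (auto simp: polydisc_def field_simps)
      then have "norm (zeval f a) \<le> C * t ^ d"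
        using C(2) t1 by blast
      also have "\<dots> \<le> C * t ^ (2 * k)"
        using t1 C(1) k by (intro mult_left_mono power_increasing) auto
      also have "\<dots> \<le> C * (\<Sum>i\<in>UNIV. (norm (a $ i) / R) ^ (2 * k))"
        unfolding j using C(1) R by (intro mult_left_mono member_le_sum) auto
      finally have "- Re (zeval f a) \<le> C * (\<Sum>i\<in>UNIV. (norm (a $ i) / R) ^ (2 * k))"
        using abs_Re_le_cmod[of "zeval f a"] by linarith
      moreover have "0 < inverse (real (Suc k))"
        by simp
      ultimately show ?thesis
        unfolding zg by linarith
    qed
    moreover have "g k \<in> real_polys"
      unfolding g_def by (intro real_polys_add real_polys_sum f real_polys_const real_polys_single_diag)
    ultimately have "0 \<le> Re (hform (g k) x x)"
      using positive x by blast
    \<comment> \<open>The hereditary calculus takes |z_i|^(2k) to the squared norm of T_i^k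
      x.\<close>
    also have "Re (hform (g k) x x) = Re (hform f x x) +
        (\<Sum>i\<in>UNIV. c k * (hnorm ((T i ^^ k) x))\<^sup>2) + inverse (real (Suc k)) * (hnorm x)\<^sup>2"
      using x pow_simps(1)[OF x]
      by (simp add: g_def hform_add hform_sum hform_single hform_const ip_self
          tuple_power_0 tuple_power_single[symmetric] del: of_nat_Suc of_real_inverse of_real_power)
    also have "(\<Sum>i\<in>UNIV. c k * (hnorm ((T i ^^ k) x))\<^sup>2) \<le>
        (\<Sum>i\<in>(UNIV :: 'n set). C * ((K / R) ^ 2) ^ k * (hnorm x)\<^sup>2)"
    proof (rule sum_mono)
      fix i
      have b: "bounded_op (T i)"
        using commuting by (simp add: commuting_tuple_def)
      have "hnorm ((T i ^^ k) x) \<le> K ^ k * hnorm x"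
        by (rule hnorm_funpow_le[OF b norm_bound K_less_R(1) x])
      then have "(hnorm ((T i ^^ k) x))\<^sup>2 \<le> (K ^ k * hnorm x)\<^sup>2"
        using x b by (intro power_mono hnorm_nonneg bounded_opE(1)[OF bounded_op_funpow])
      then have "c k * (hnorm ((T i ^^ k) x))\<^sup>2 \<le> c k * (K ^ k * hnorm x)\<^sup>2"
        using C(1) R by (intro mult_left_mono) (auto simp: c_def)
      also have "\<dots> = C * ((K / R) ^ 2) ^ k * (hnorm x)\<^sup>2"
        by (simp add: c_def power_mult_distrib power_divide power_mult[symmetric] mult.commute[of k 2])
      finally show "c k * (hnorm ((T i ^^ k) x))\<^sup>2 \<le> C * ((K / R) ^ 2) ^ k * (hnorm x)\<^sup>2" .
    qed
    finally show ?thesis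
      by (simp add: N_def algebra_simps del: of_nat_Suc)
  qed
  have "(K / R) ^ 2 < 1"
    using K_less_R R by (simp add: power_less_one_iff power_divide) (simp add: power_strict_mono)
  then have "?b \<longlonglongrightarrow> - (N * C * 0 + 0) * (hnorm x)\<^sup>2"
    by (intro tendsto_mult tendsto_add tendsto_minus tendsto_const LIMSEQ_power_zero
        LIMSEQ_inverse_real_of_nat) auto
  then have "- (N * C * 0 + 0) * (hnorm x)\<^sup>2 \<le> Re (hform f x x)"
    by (rule LIMSEQ_le_const2) (use est in blast)
  then show ?thesis by simp
qed

text \<open>Positivity applied to e + f and e - f: the calculus is continuous for the supremum norm
  on the polydisc.\<close>

lemma norm_hform_real_le:
  assumes f: "f \<in> real_polys" "\<And>a. a \<in> polydisc R \<Longrightarrow> \<bar>Re (zeval f a)\<bar> \<le> e" and x: "x \<in> H"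
  shows "norm (hform f x x) \<le> e * (hnorm x)\<^sup>2"
proof -
  let ?e = "const_poly (of_real e)"
  have c: "Re (hform ?e x x) = e * (hnorm x)\<^sup>2"
    using x by (simp add: hform_const ip_self)
  have "0 \<le> Re (hform (?e + f) x x)" "0 \<le> Re (hform (?e - f) x x)"
    using f by (auto intro!: hform_nonneg real_polys_add real_polys_diff real_polys_const x
        simp: zeval_add zeval_diff zeval_const abs_le_iff)
      (smt (verit))+
  then have "\<bar>Re (hform f x x)\<bar> \<le> e * (hnorm x)\<^sup>2"
    by (simp add: hform_add hform_diff c del: of_real_power)
  then show ?thesis
    by (subst hform_real_polys[OF f(1) x]) (simp only: norm_of_real)
qed

lemma norm_hform_diag_le:
  assumes f: "\<And>a. a \<in> polydisc R \<Longrightarrow> norm (zeval f a) \<le> e" and x: "x \<in> H"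
  shows "norm (hform f x x) \<le> 2 * e * (hnorm x)\<^sup>2"
proof -
  obtain g h where gh: "g \<in> real_polys" "h \<in> real_polys" "f = g + const_poly \<i> * h"
    "\<And>a. Re (zeval g a) = Re (zeval f a)" "\<And>a. Re (zeval h a) = Im (zeval f a)"
    using zpoly_real_imag_parts[of f] by metis
  have "norm (hform g x x) \<le> e * (hnorm x)\<^sup>2" "norm (hform h x x) \<le> e * (hnorm x)\<^sup>2"
    using gh(4,5) f abs_Re_le_cmod abs_Im_le_cmod
    by (intro norm_hform_real_le gh(1,2) x; metis order_trans)+
  moreover have "norm (hform f x x) \<le> norm (hform g x x) + norm (hform h x x)"
    using norm_triangle_ineq[of "hform g x x" "\<i> * hform h x x"]
    by (simp add: gh(3) hform_add hform_const_mult norm_mult)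
  ultimately show ?thesis by linarith
qed

text \<open>Polarisation of the diagonal estimate. The constant is generous; what counts is that the
  bound is linear in \<open>e\<close>, which later tends to 0.\<close>

lemma norm_hform_le:
  assumes f: "\<And>a. a \<in> polydisc R \<Longrightarrow> norm (zeval f a) \<le> e" and x: "x \<in> H" and y: "y \<in> H"
  shows "norm (hform f x y) \<le> 2 * e * (hnorm x + hnorm y)\<^sup>2"
proof -
  define q where "q c = hform f (x + c *s y) (x + c *s y)" for c
  have "4 * hform f x y = q 1 + \<i> * q \<i> - q (-1) - \<i> * q (- \<i>)"
    using x y by (simp add: q_def hform_add_left hform_add_right hform_scale_left hform_scale_right
        carrier_simps algebra_simps del: scale_minus_left scale_one)
  moreover have "norm (q c) \<le> 2 * e * (hnorm x + hnorm y)\<^sup>2" if "norm c = 1" for c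
  proof -
    have "0 \<le> e"
      using f[of 0] K_less_R norm_ge_zero[of "zeval f 0"]
      by (auto simp: polydisc_def simp del: norm_ge_zero)
    have "hnorm (x + c *s y) \<le> hnorm x + hnorm y"
      using hnorm_triangle[of x "c *s y"] x y that by (simp add: carrier_simps hnorm_scale)
    then have "(hnorm (x + c *s y))\<^sup>2 \<le> (hnorm x + hnorm y)\<^sup>2"
      using x y by (intro power_mono hnorm_nonneg) (auto simp: carrier_simps)
    then have "2 * e * (hnorm (x + c *s y))\<^sup>2 \<le> 2 * e * (hnorm x + hnorm y)\<^sup>2"
      using \<open>0 \<le> e\<close> by (intro mult_left_mono) auto
    then show ?thesis
      using norm_hform_diag_le[OF f, of "x + c *s y"] x y by (auto simp: q_def carrier_simps)
  qed
  note this[of 1] this[of \<i>] this[of "-1"] this[of "- \<i>"]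
  moreover have "norm (q 1 + \<i> * q \<i> - q (-1) - \<i> * q (- \<i>)) \<le>
      norm (q 1) + norm (q \<i>) + norm (q (-1)) + norm (q (- \<i>))"
    using norm_triangle_ineq[of "q 1" "\<i> * q \<i>"] norm_triangle_ineq4[of "q 1 + \<i> * q \<i>" "q (-1)"]
      norm_triangle_ineq4[of "q 1 + \<i> * q \<i> - q (-1)" "\<i> * q (- \<i>)"]
    by (simp add: norm_mult)
  ultimately have "norm (4 * hform f x y) \<le> 4 * (2 * e * (hnorm x + hnorm y)\<^sup>2)"
    by simp
  then show ?thesis
    by (simp add: norm_mult)
qed

text \<open>A positive map on a commutative algebra is completely positive: a polynomial partition of unity
  reduces the matrix inequality to the scalar case.\<close>

lemma list_form_hform_nonneg:
  assumes w: "w \<in> real_polys" "\<And>a. a \<in> polydisc R \<Longrightarrow> 0 \<le> Re (zeval w a)"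
    and u: "\<And>p. p \<in> set u \<Longrightarrow> snd p \<in> H"
  shows "0 \<le> Re (list_form (\<lambda>p q. hform (w * zmono (fst p) * star (zmono (fst q))) (snd p) (snd q)) u u)"
    (is "0 \<le> Re ?Q")
proof -
  let ?F = "\<lambda>p q. w * zmono (fst p) * star (zmono (fst q))"
  \<comment> \<open>\<open>e * C\<close> bounds the total error when every matrix entry is
    approximated within \<open>e\<close> on the polydisc.\<close>
  define C where "C = (\<Sum>p\<leftarrow>u. \<Sum>q\<leftarrow>u. 2 * (hnorm (snd p) + hnorm (snd q))\<^sup>2)"
  have C: "0 \<le> C"
    unfolding C_def by (intro sum_list_nonneg) (auto intro!: sum_list_nonneg)
  have "- (e * C) \<le> Re ?Q" if e: "0 < e" for e
  proof -
    obtain Z h where Z: "finite Z" "\<And>z. z \<in> Z \<Longrightarrow> h z \<in> real_polys"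
      "\<And>z a. \<lbrakk>z \<in> Z; a \<in> polydisc R\<rbrakk> \<Longrightarrow> 0 \<le> Re (zeval (h z) a)"
      "\<And>k l a. \<lbrakk>k \<in> fst ` set u; l \<in> fst ` set u; a \<in> polydisc R\<rbrakk> \<Longrightarrow>
         norm (zeval (w * zmono k * star (zmono l)) a -
           (\<Sum>z\<in>Z. mono_eval z k * cnj (mono_eval z l) * zeval (h z) a)) \<le> e"
      using polynomial_partition[OF _ w e, of "fst ` set u"] by auto
    let ?G = "\<lambda>p q. \<Sum>z\<in>Z. const_poly (mono_eval z (fst p) * cnj (mono_eval z (fst q))) * h z"
    have "norm (list_form (\<lambda>p q. hform (?F p q - ?G p q) (snd p) (snd q)) u u) \<le>
        (\<Sum>p\<leftarrow>u. \<Sum>q\<leftarrow>u. 2 * e * (hnorm (snd p) + hnorm (snd q))\<^sup>2)"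
      using Z(4) u by (intro norm_list_form_le norm_hform_le)
        (auto simp: zeval_diff zeval_sum zeval_mult[of "const_poly _"] zeval_const)
    also have "\<dots> = e * C"
      by (simp add: C_def mult_ac flip: sum_list_const_mult)
    finally have "- (e * C) \<le> Re (list_form (\<lambda>p q. hform (?F p q - ?G p q) (snd p) (snd q)) u u)"
      using abs_Re_le_cmod by (smt (verit))
    moreover have "0 \<le> Re (list_form (\<lambda>p q. hform (?G p q) (snd p) (snd q)) u u)"
    proof -
      \<comment> \<open>The rank-one coefficients are absorbed into one vector per net point, so the
        double sum over \<open>u\<close> becomes the diagonal value of \<open>h z\<close> at
        \<open>X z\<close>.\<close>
      define X where "X z = (\<Sum>p\<leftarrow>u. mono_eval z (fst p) *s snd p)" for z
      have X: "X z \<in> H" for z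
        unfolding X_def using hform_combination_left[of 0 u snd "\<lambda>p. mono_eval z (fst p)"] u
        by (auto simp: carrier_simps)
      have "list_form (\<lambda>p q. hform (?G p q) (snd p) (snd q)) u u = (\<Sum>z\<in>Z. hform (h z) (X z) (X z))"
      proof -
        have "hform (h z) (X z) (X z) = list_form (\<lambda>p q. mono_eval z (fst p) * cnj (mono_eval z (fst q)) *
            hform (h z) (snd p) (snd q)) u u" for z
        proof -
          have "hform (h z) (X z) (X z) = (\<Sum>p\<leftarrow>u. mono_eval z (fst p) * hform (h z) (snd p) (X z))"
            unfolding X_def[of z, THEN arg_cong[of _ _ "\<lambda>v. hform (h z) v (X z)"]]
            by (rule conjunct2[OF hform_combination_left]) (use u X in auto)
          also have "\<dots> = (\<Sum>p\<leftarrow>u. mono_eval z (fst p) *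
              (\<Sum>q\<leftarrow>u. cnj (mono_eval z (fst q)) * hform (h z) (snd p) (snd q)))"
            using u unfolding X_def
            by (intro arg_cong[of _ _ sum_list] map_cong refl) (simp add: hform_combination_right)
          finally show ?thesis
            by (simp add: list_form_def mult.assoc flip: sum_list_const_mult)
        qed
        then show ?thesis
          by (simp add: hform_sum hform_const_mult list_form_sum)
      qed
      then show ?thesis
        using Z X by (auto intro!: sum_nonneg hform_nonneg)
    qed
    moreover have "?Q = list_form (\<lambda>p q. hform (?F p q - ?G p q) (snd p) (snd q)) u u +
        list_form (\<lambda>p q. hform (?G p q) (snd p) (snd q)) u u"
      by (simp add: hform_diff flip: list_form_add)
    ultimately show ?thesis by simp
  qed
  note bound = this
  show ?thesis
  proof (rule field_le_epsilon)
    fix e :: real assume e: "0 < e"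
    then have "e / (C + 1) * C \<le> e"
      using C by (simp add: field_simps)
    then show "0 \<le> Re ?Q + e"
      using bound[of "e / (C + 1)"] e C by (smt (verit) divide_pos_pos)
  qed
qed

end


section \<open>Completion of a separable semi-inner product\<close>

text \<open>Linearity is visible only through \<open>s\<close>: in the application the elements are
  lists and \<open>add\<close> is concatenation, so the same vector has many different
  elements.\<close>

locale semi_inner =
  fixes F :: "'f set" and add :: "'f \<Rightarrow> 'f \<Rightarrow> 'f" and scl :: "complex \<Rightarrow> 'f \<Rightarrow> 'f"
    and s :: "'f \<Rightarrow> 'f \<Rightarrow> complex"
  assumes add_in: "\<lbrakk>u \<in> F; v \<in> F\<rbrakk> \<Longrightarrow> add u v \<in> F"
    and scl_in: "u \<in> F \<Longrightarrow> scl c u \<in> F"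
    and s_add: "\<lbrakk>u \<in> F; v \<in> F; w \<in> F\<rbrakk> \<Longrightarrow> s (add u v) w = s u w + s v w"
    and s_scl: "\<lbrakk>u \<in> F; w \<in> F\<rbrakk> \<Longrightarrow> s (scl c u) w = c * s u w"
    and s_cnj: "\<lbrakk>u \<in> F; w \<in> F\<rbrakk> \<Longrightarrow> s u w = cnj (s w u)"
    and s_nonneg: "u \<in> F \<Longrightarrow> 0 \<le> Re (s u u)"
begin

definition sub :: "'f \<Rightarrow> 'f \<Rightarrow> 'f"
  where "sub u v = add u (scl (- 1) v)"

definition nrm :: "'f \<Rightarrow> real"
  where "nrm u = sqrt (Re (s u u))"

lemma sub_in: "\<lbrakk>u \<in> F; v \<in> F\<rbrakk> \<Longrightarrow> sub u v \<in> F"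
  by (simp add: sub_def add_in scl_in)

lemmas F_in = add_in scl_in sub_in

lemma s_sub: "\<lbrakk>u \<in> F; v \<in> F; w \<in> F\<rbrakk> \<Longrightarrow> s (sub u v) w = s u w - s v w"
  by (simp add: sub_def s_add s_scl F_in)

lemma s_add_right: "\<lbrakk>u \<in> F; v \<in> F; w \<in> F\<rbrakk> \<Longrightarrow> s w (add u v) = s w u + s w v"
  using s_cnj[of w "add u v"] s_cnj[of w u] s_cnj[of w v] by (simp add: s_add F_in)

lemma s_scl_right: "\<lbrakk>u \<in> F; w \<in> F\<rbrakk> \<Longrightarrow> s w (scl c u) = cnj c * s w u"
  using s_cnj[of w "scl c u"] s_cnj[of w u] by (simp add: s_scl F_in)

lemma s_sub_right: "\<lbrakk>u \<in> F; v \<in> F; w \<in> F\<rbrakk> \<Longrightarrow> s w (sub u v) = s w u - s w v"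
  by (simp add: sub_def s_add_right s_scl_right F_in)

lemmas s_simps = s_add s_scl s_sub s_add_right s_scl_right s_sub_right

lemma nrm_nonneg: "u \<in> F \<Longrightarrow> 0 \<le> nrm u"
  by (simp add: nrm_def s_nonneg)

lemma nrm_power2: "u \<in> F \<Longrightarrow> (nrm u)\<^sup>2 = Re (s u u)"
  by (simp add: nrm_def s_nonneg)

lemma norm_s_le:
  assumes u: "u \<in> F" and v: "v \<in> F"
  shows "norm (s u v) \<le> nrm u * nrm v"
proof -
  let ?A = "Re (s u u)" and ?B = "Re (s v v)" and ?m = "norm (s u v)"
  \<comment> \<open>The phase of \<open>s u v\<close>; it is 0 when \<open>s u v\<close> is, so only
    |c| \<le> 1 is available below.\<close>
  define c where "c = sgn (s u v)"
  have c1: "cnj c * s u v = of_real ?m"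
  proof (cases "s u v = 0")
    case False
    then show ?thesis
      using complex_norm_square[of "s u v"]
      by (simp add: c_def sgn_div_norm scaleR_conv_of_real power2_eq_square field_simps)
  qed simp
  then have "cnj (cnj c * s u v) = cnj (of_real ?m)"
    by (rule arg_cong)
  then have c2: "c * cnj (s u v) = of_real ?m"
    by simp
  have quad: "0 \<le> ?A - 2 * t * ?m + t\<^sup>2 * ?B" for t
  proof -
    have "0 \<le> Re (s (add u (scl (- of_real t * c) v)) (add u (scl (- of_real t * c) v)))"
      using u v by (intro s_nonneg F_in)
    also have "\<dots> = ?A - t * Re (cnj c * s u v) - t * Re (c * cnj (s u v)) + t\<^sup>2 * Re (c * cnj c * s v v)"
      using u v s_cnj[OF v u] by (simp add: s_simps F_in algebra_simps power2_eq_square)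
    finally have "0 \<le> ?A - t * Re (cnj c * s u v) - t * Re (c * cnj (s u v)) +
        t\<^sup>2 * Re (c * cnj c * s v v)" .
    moreover have "Re (c * cnj c * s v v) \<le> ?B"
    proof -
      have "c * cnj c = of_real ((norm c)\<^sup>2)"
        by (rule complex_norm_square[symmetric])
      then have "Re (c * cnj c * s v v) = (norm c)\<^sup>2 * ?B"
        by (simp only: Re_complex_of_real times_complex.sel Im_complex_of_real mult_zero_left diff_zero)
      moreover have "(norm c)\<^sup>2 \<le> 1"
        by (simp add: c_def norm_sgn)
      ultimately show ?thesis
        using s_nonneg[OF v] mult_right_mono[of "(norm c)\<^sup>2" 1 ?B] by linarith
    qed
    then have "t\<^sup>2 * Re (c * cnj c * s v v) \<le> t\<^sup>2 * ?B"
      by (rule mult_left_mono) simp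
    ultimately show ?thesis
      unfolding c1 c2 Re_complex_of_real by linarith
  qed
  show ?thesis
  proof (cases "?B = 0")
    case True
    have "?m = 0"
    proof (rule ccontr)
      assume m: "?m \<noteq> 0"
      \<comment> \<open>Without the quadratic term the bound is linear in t, and this t makes it
        equal to -1.\<close>
      then have "0 \<le> ?A - 2 * ((?A + 1) / (2 * ?m)) * ?m"
        using quad[of "(?A + 1) / (2 * ?m)"] True by simp
      then show False using m by (simp add: field_simps)
    qed
    then show ?thesis
      using u v by (simp add: nrm_nonneg)
  next
    case False
    then have B: "0 < ?B"
      using s_nonneg[OF v] by linarith
    have "0 \<le> ?A - 2 * (?m / ?B) * ?m + (?m / ?B)\<^sup>2 * ?B"
      by (rule quad)
    also have "\<dots> = ?A - ?m\<^sup>2 / ?B"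
      using B by (simp add: power2_eq_square field_simps)
    finally have "?m\<^sup>2 \<le> ?A * ?B"
      using B by (simp add: field_simps)
    then have "?m \<le> sqrt (?A * ?B)"
      by (rule real_le_rsqrt)
    then show ?thesis
      by (simp add: nrm_def real_sqrt_mult)
  qed
qed

lemma nrm_scl: "u \<in> F \<Longrightarrow> nrm (scl c u) = norm c * nrm u"
proof -
  assume u: "u \<in> F"
  have "s (scl c u) (scl c u) = (c * cnj c) * s u u"
    using u by (simp add: s_simps F_in)
  also have "c * cnj c = of_real ((norm c)\<^sup>2)"
    by (rule complex_norm_square[symmetric])
  finally have "Re (s (scl c u) (scl c u)) = (norm c)\<^sup>2 * Re (s u u)"
    by (simp only: Re_complex_of_real times_complex.sel Im_complex_of_real mult_zero_left diff_zero)
  then show ?thesis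
    by (simp add: nrm_def real_sqrt_mult)
qed

lemma nrm_add_le:
  assumes u: "u \<in> F" and v: "v \<in> F"
  shows "nrm (add u v) \<le> nrm u + nrm v"
proof -
  have "(nrm (add u v))\<^sup>2 = (nrm u)\<^sup>2 + 2 * Re (s u v) + (nrm v)\<^sup>2"
    using u v s_cnj[OF v u] by (simp add: nrm_power2 s_simps F_in)
  also have "\<dots> \<le> (nrm u + nrm v)\<^sup>2"
    using norm_s_le[OF u v] complex_Re_le_cmod[of "s u v"] by (simp add: power2_sum)
  finally show ?thesis
    using u v nrm_nonneg by (meson add_nonneg_nonneg power2_le_imp_le)
qed

text \<open>Stands in for equality of vectors: elements that differ as lists have equal norm as soon
  as their form values agree.\<close>

lemma nrm_eqI: "s u u = s v v \<Longrightarrow> nrm u = nrm v"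
  by (simp add: nrm_def)

lemma nrm_sub_add_le:
  assumes "u \<in> F" "v \<in> F" "u' \<in> F" "v' \<in> F"
  shows "nrm (sub (add u v) (add u' v')) \<le> nrm (sub u u') + nrm (sub v v')"
proof -
  have "nrm (sub (add u v) (add u' v')) = nrm (add (sub u u') (sub v v'))"
    using assms by (intro nrm_eqI) (simp add: s_simps F_in)
  then show ?thesis
    using nrm_add_le[of "sub u u'" "sub v v'"] assms by (simp add: F_in)
qed

lemma nrm_le_sub: "\<lbrakk>u \<in> F; v \<in> F\<rbrakk> \<Longrightarrow> nrm u \<le> nrm v + nrm (sub u v)"
proof -
  assume uv: "u \<in> F" "v \<in> F"
  have "nrm u = nrm (add v (sub u v))"
    using uv by (intro nrm_eqI) (simp add: s_simps F_in)
  then show ?thesis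
    using nrm_add_le[of v "sub u v"] uv by (simp add: F_in)
qed

section \<open>Cauchy sequences for the seminorm\<close>

definition cauchy :: "(nat \<Rightarrow> 'f) \<Rightarrow> bool"
  where "cauchy u \<longleftrightarrow> range u \<subseteq> F \<and> (\<forall>e>0. \<exists>N. \<forall>m\<ge>N. \<forall>n\<ge>N. nrm (sub (u m) (u n)) < e)"

lemma cauchy_in: "cauchy u \<Longrightarrow> u n \<in> F"
  by (auto simp: cauchy_def)

lemma cauchyD:
  assumes "cauchy u" "0 < e"
  obtains N where "\<And>m n. \<lbrakk>N \<le> m; N \<le> n\<rbrakk> \<Longrightarrow> nrm (sub (u m) (u n)) < e"
  using assms unfolding cauchy_def by meson

lemma cauchy_bounded:
  assumes "cauchy u"
  obtains B where "0 < B" "eventually (\<lambda>n. nrm (u n) \<le> B) sequentially"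
proof -
  obtain N where N: "\<And>m n. \<lbrakk>N \<le> m; N \<le> n\<rbrakk> \<Longrightarrow> nrm (sub (u m) (u n)) < 1"
    using cauchyD[OF assms, of 1] by auto
  have "nrm (u n) \<le> nrm (u N) + 1" if "N \<le> n" for n
    using nrm_le_sub[of "u n" "u N"] N[OF that le_refl] cauchy_in[OF assms] by force
  then have "eventually (\<lambda>n. nrm (u n) \<le> nrm (u N) + 1) sequentially"
    by (auto simp: eventually_sequentially)
  moreover have "0 < nrm (u N) + 1"
    using nrm_nonneg[OF cauchy_in[OF assms]] by (simp add: add_nonneg_pos)
  ultimately show ?thesis
    using that by blast
qed

lemma cauchy_add: "\<lbrakk>cauchy u; cauchy v\<rbrakk> \<Longrightarrow> cauchy (\<lambda>n. add (u n) (v n))"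
proof -
  assume uv: "cauchy u" "cauchy v"
  have "\<exists>N. \<forall>m\<ge>N. \<forall>n\<ge>N. nrm (sub (add (u m) (v m)) (add (u n) (v n))) < e" if "0 < e" for e
  proof -
    obtain M where M: "\<And>m n. \<lbrakk>M \<le> m; M \<le> n\<rbrakk> \<Longrightarrow> nrm (sub (u m) (u n)) < e / 2"
      using cauchyD[OF uv(1), of "e / 2"] \<open>0 < e\<close> by auto
    obtain N where N: "\<And>m n. \<lbrakk>N \<le> m; N \<le> n\<rbrakk> \<Longrightarrow> nrm (sub (v m) (v n)) < e / 2"
      using cauchyD[OF uv(2), of "e / 2"] \<open>0 < e\<close> by auto
    have "nrm (sub (add (u m) (v m)) (add (u n) (v n))) < e" if "max M N \<le> m" "max M N \<le> n" for m n
      using nrm_sub_add_le[of "u m" "v m" "u n" "v n"] M[of m n] N[of m n] that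
        cauchy_in[OF uv(1)] cauchy_in[OF uv(2)] by force
    then show ?thesis by blast
  qed
  then show ?thesis
    using uv by (auto simp: cauchy_def intro!: add_in)
qed

lemma cauchy_scl: "cauchy u \<Longrightarrow> cauchy (\<lambda>n. scl c (u n))"
proof -
  assume u: "cauchy u"
  have "\<exists>N. \<forall>m\<ge>N. \<forall>n\<ge>N. nrm (sub (scl c (u m)) (scl c (u n))) < e" if "0 < e" for e
  proof -
    have "0 < e / (norm c + 1)"
      using \<open>0 < e\<close> by (simp add: add_nonneg_pos)
    then obtain N where N: "\<And>m n. \<lbrakk>N \<le> m; N \<le> n\<rbrakk> \<Longrightarrow> nrm (sub (u m) (u n)) < e / (norm c + 1)"
      using cauchyD[OF u] by metis
    have "nrm (sub (scl c (u m)) (scl c (u n))) < e" if "N \<le> m" "N \<le> n" for m n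
    proof -
      have "nrm (sub (scl c (u m)) (scl c (u n))) = nrm (scl c (sub (u m) (u n)))"
        using cauchy_in[OF u] by (intro nrm_eqI) (simp add: s_simps F_in algebra_simps)
      also have "\<dots> = norm c * nrm (sub (u m) (u n))"
        using cauchy_in[OF u] by (simp add: nrm_scl F_in)
      also have "\<dots> \<le> (norm c + 1) * nrm (sub (u m) (u n))"
        using cauchy_in[OF u] by (intro mult_right_mono) (auto simp: nrm_nonneg F_in)
      also have "\<dots> < (norm c + 1) * (e / (norm c + 1))"
        using N[OF that] by (intro mult_strict_left_mono) (auto simp: add_nonneg_pos)
      also have "\<dots> = e"
        using norm_ge_zero[of c] by (simp add: field_simps add_nonneg_eq_0_iff)
      finally show ?thesis .
    qed
    then show ?thesis by blast
  qed
  then show ?thesis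
    using u by (auto simp: cauchy_def intro!: scl_in)
qed

lemma cauchy_sub: "\<lbrakk>cauchy u; cauchy v\<rbrakk> \<Longrightarrow> cauchy (\<lambda>n. sub (u n) (v n))"
  unfolding sub_def by (intro cauchy_add cauchy_scl)

lemma cauchy_const: "v \<in> F \<Longrightarrow> cauchy (\<lambda>n. v)"
  by (auto simp: cauchy_def nrm_def s_simps F_in)

lemma s_tendsto_0:
  assumes "cauchy u" "\<And>n. v n \<in> F" "(\<lambda>n. nrm (v n)) \<longlonglongrightarrow> 0"
  shows "(\<lambda>n. s (u n) (v n)) \<longlonglongrightarrow> 0" "(\<lambda>n. s (v n) (u n)) \<longlonglongrightarrow> 0"
proof -
  obtain B where B: "0 < B" "eventually (\<lambda>n. nrm (u n) \<le> B) sequentially"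
    using cauchy_bounded[OF assms(1)] by blast
  have lim: "(\<lambda>n. B * nrm (v n)) \<longlonglongrightarrow> 0"
    using tendsto_mult_left[OF assms(3), of B] by simp
  have "norm (s (u n) (v n)) \<le> B * nrm (v n)" "norm (s (v n) (u n)) \<le> B * nrm (v n)"
    if "nrm (u n) \<le> B" for n
    using norm_s_le[of "u n" "v n"] norm_s_le[of "v n" "u n"] cauchy_in[OF assms(1), of n] assms(2)[of n]
      mult_right_mono[OF that nrm_nonneg[OF assms(2)[of n]]] by (simp_all add: mult.commute)
  then have "eventually (\<lambda>n. norm (s (u n) (v n)) \<le> B * nrm (v n)) sequentially"
    "eventually (\<lambda>n. norm (s (v n) (u n)) \<le> B * nrm (v n)) sequentially"
    using B(2) by (auto elim: eventually_mono)
  then show "(\<lambda>n. s (u n) (v n)) \<longlonglongrightarrow> 0" "(\<lambda>n. s (v n) (u n)) \<longlonglongrightarrow> 0"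
    using lim by (auto intro: Lim_null_comparison)
qed

lemma convergent_s:
  assumes u: "cauchy u" and v: "cauchy v"
  shows "convergent (\<lambda>n. s (u n) (v n))"
proof -
  obtain B where B: "0 < B" "eventually (\<lambda>n. nrm (u n) \<le> B) sequentially"
    using cauchy_bounded[OF u] by blast
  obtain C where C: "0 < C" "eventually (\<lambda>n. nrm (v n) \<le> C) sequentially"
    using cauchy_bounded[OF v] by blast
  obtain K where K: "\<And>n. K \<le> n \<Longrightarrow> nrm (u n) \<le> B \<and> nrm (v n) \<le> C"
    using eventually_conj[OF B(2) C(2)] by (auto simp: eventually_sequentially)
  have "Cauchy (\<lambda>n. s (u n) (v n))"
  proof (rule CauchyI)
    fix e :: real assume e: "0 < e"
    obtain M where M: "\<And>m n. \<lbrakk>M \<le> m; M \<le> n\<rbrakk> \<Longrightarrow> nrm (sub (u m) (u n)) < e / (2 * C)"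
      using cauchyD[OF u, of "e / (2 * C)"] e C(1) by auto
    obtain N where N: "\<And>m n. \<lbrakk>N \<le> m; N \<le> n\<rbrakk> \<Longrightarrow> nrm (sub (v m) (v n)) < e / (2 * B)"
      using cauchyD[OF v, of "e / (2 * B)"] e B(1) by auto
    have "norm (s (u m) (v m) - s (u n) (v n)) < e" if "Max {K, M, N} \<le> m" "Max {K, M, N} \<le> n" for m n
    proof -
      have in_F: "u m \<in> F" "u n \<in> F" "v m \<in> F" "v n \<in> F"
        using cauchy_in u v by auto
      have "s (u m) (v m) - s (u n) (v n) = s (sub (u m) (u n)) (v m) + s (u n) (sub (v m) (v n))"
        using in_F by (simp add: s_simps)
      then have "norm (s (u m) (v m) - s (u n) (v n)) \<le>
          nrm (sub (u m) (u n)) * nrm (v m) + nrm (u n) * nrm (sub (v m) (v n))"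
        using norm_triangle_mono[OF norm_s_le norm_s_le] in_F by (simp add: F_in)
      also have "nrm (sub (u m) (u n)) * nrm (v m) \<le> nrm (sub (u m) (u n)) * C"
        using K[of m] that in_F by (intro mult_left_mono nrm_nonneg F_in) auto
      also have "\<dots> < e / (2 * C) * C"
        using M[of m n] that C(1) by (intro mult_strict_right_mono) auto
      also have "nrm (u n) * nrm (sub (v m) (v n)) \<le> B * nrm (sub (v m) (v n))"
        using K[of n] that in_F by (intro mult_right_mono nrm_nonneg F_in) auto
      also have "\<dots> < B * (e / (2 * B))"
        using N[of m n] that B(1) by (intro mult_strict_left_mono) auto
      finally show ?thesis
        using B(1) C(1) by simp
    qed
    then show "\<exists>M. \<forall>m\<ge>M. \<forall>n\<ge>M. norm (s (u m) (v m) - s (u n) (v n)) < e"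
      by blast
  qed
  then show ?thesis
    by (simp add: Cauchy_convergent_iff)
qed

end

text \<open>The completion consists of the functions \<open>k \<mapsto> lim\<^sub>n s (u\<^sub>n) (d\<^sub>k)\<close> for Cauchy sequences \<open>u\<close>;
  since the \<open>d\<^sub>k\<close> are dense, such a function determines \<open>u\<close> up to a null sequence.\<close>

locale separable_semi_inner = semi_inner +
  fixes d :: "nat \<Rightarrow> 'a"
  assumes d_in: "d k \<in> F"
    and dense: "\<lbrakk>u \<in> F; 0 < e\<rbrakk> \<Longrightarrow> \<exists>k. nrm (sub u (d k)) < e"
begin

definition rep :: "(nat \<Rightarrow> 'a) \<Rightarrow> (nat \<Rightarrow> complex) \<Rightarrow> bool"
  where "rep u \<phi> \<longleftrightarrow> cauchy u \<and> (\<forall>k. (\<lambda>n. s (u n) (d k)) \<longlonglongrightarrow> \<phi> k)"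

definition emb :: "'a \<Rightarrow> nat \<Rightarrow> complex"
  where "emb v k = s v (d k)"

lemma rep_in: "rep u \<phi> \<Longrightarrow> u n \<in> F"
  by (simp add: rep_def cauchy_in)

lemma rep_emb: "v \<in> F \<Longrightarrow> rep (\<lambda>n. v) (emb v)"
  by (simp add: rep_def emb_def cauchy_const)

lemma rep_add: "\<lbrakk>rep u \<phi>; rep v \<psi>\<rbrakk> \<Longrightarrow> rep (\<lambda>n. add (u n) (v n)) (\<phi> + \<psi>)"
  by (auto simp: rep_def cauchy_add cauchy_in d_in s_simps intro!: tendsto_add)

lemma rep_scl: "rep u \<phi> \<Longrightarrow> rep (\<lambda>n. scl c (u n)) (\<lambda>k. c * \<phi> k)"
  by (auto simp: rep_def cauchy_scl cauchy_in d_in s_simps intro!: tendsto_intros)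

lemma rep_sub: "\<lbrakk>rep u \<phi>; rep v \<psi>\<rbrakk> \<Longrightarrow> rep (\<lambda>n. sub (u n) (v n)) (\<phi> - \<psi>)"
  by (auto simp: rep_def cauchy_sub cauchy_in d_in s_simps intro!: tendsto_diff)

lemma cauchy_imp_rep:
  assumes "cauchy u"
  obtains \<phi> where "rep u \<phi>"
  using convergent_s[OF assms cauchy_const[OF d_in]] assms
  unfolding rep_def convergent_def by metis

text \<open>Weak convergence along the dense family becomes norm convergence because the sequence is
  Cauchy: for large n, \<open>u n\<close> is close to a fixed \<open>u N\<close>, that one is close
  to some \<open>d k\<close>, and \<open>s (u n) (d k)\<close> tends to 0. Each of the three
  contributions is below e/3 or at most e/3.\<close>

lemma rep_zero_tendsto:
  assumes "rep u 0"
  shows "(\<lambda>n. nrm (u n)) \<longlonglongrightarrow> 0"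
proof -
  have u: "cauchy u" and lim: "\<And>k. (\<lambda>n. s (u n) (d k)) \<longlonglongrightarrow> 0"
    using assms by (auto simp: rep_def)
  note in_F = cauchy_in[OF u]
  obtain B where B: "0 < B" "eventually (\<lambda>n. nrm (u n) \<le> B) sequentially"
    using cauchy_bounded[OF u] by blast
  have "(\<lambda>n. s (u n) (u n)) \<longlonglongrightarrow> 0"
  proof (rule tendstoI)
    fix e :: real assume e: "0 < e"
    define r where "r = e / (3 * B)"
    have r: "0 < r"
      using e B(1) by (simp add: r_def)
    obtain N where N: "\<And>m n. \<lbrakk>N \<le> m; N \<le> n\<rbrakk> \<Longrightarrow> nrm (sub (u m) (u n)) < r"
      using cauchyD[OF u r] by blast
    obtain k where k: "nrm (sub (u N) (d k)) < r"
      using dense[OF in_F r] by blast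
    have "eventually (\<lambda>n. norm (s (u n) (d k)) < e / 3) sequentially"
      using tendstoD[OF lim, of "e / 3" k] e by simp
    with B(2) eventually_ge_at_top[of N]
    show "eventually (\<lambda>n. dist (s (u n) (u n)) 0 < e) sequentially"
    proof eventually_elim
      case (elim n)
      have "s (u n) (u n) = s (u n) (sub (u n) (u N)) + s (u n) (sub (u N) (d k)) + s (u n) (d k)"
        using in_F d_in by (simp add: s_simps F_in)
      then have "norm (s (u n) (u n)) \<le> norm (s (u n) (sub (u n) (u N)))
          + norm (s (u n) (sub (u N) (d k))) + norm (s (u n) (d k))"
        using norm_triangle_ineq[of "s (u n) (sub (u n) (u N)) + s (u n) (sub (u N) (d k))" "s (u n) (d k)"]
          norm_triangle_ineq[of "s (u n) (sub (u n) (u N))" "s (u n) (sub (u N) (d k))"] by simp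
      moreover have "norm (s (u n) (sub (u n) (u N))) \<le> B * r"
        using norm_s_le[of "u n" "sub (u n) (u N)"] elim N[OF elim(2) le_refl] in_F B(1)
          mult_mono[of "nrm (u n)" B "nrm (sub (u n) (u N))" r] nrm_nonneg by (auto simp: F_in)
      moreover have "norm (s (u n) (sub (u N) (d k))) \<le> B * r"
        using norm_s_le[of "u n" "sub (u N) (d k)"] elim k in_F B(1) d_in
          mult_mono[of "nrm (u n)" B "nrm (sub (u N) (d k))" r] nrm_nonneg by (auto simp: F_in)
      moreover have "B * r = e / 3"
        using B(1) by (simp add: r_def)
      ultimately show ?case
        using elim(3) by simp
    qed
  qed
  then have "(\<lambda>n. sqrt (Re (s (u n) (u n)))) \<longlonglongrightarrow> sqrt (Re 0)"
    by (intro tendsto_intros)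
  then show ?thesis
    by (simp add: nrm_def)
qed

section \<open>The Hilbert space of limits\<close>

definition carrier :: "(nat \<Rightarrow> complex) set"
  where "carrier = {\<phi>. \<exists>u. rep u \<phi>}"

definition chosen_rep :: "(nat \<Rightarrow> complex) \<Rightarrow> nat \<Rightarrow> 'a"
  where "chosen_rep \<phi> = (SOME u. rep u \<phi>)"

definition cip :: "(nat \<Rightarrow> complex) \<Rightarrow> (nat \<Rightarrow> complex) \<Rightarrow> complex"
  where "cip \<phi> \<psi> = lim (\<lambda>n. s (chosen_rep \<phi> n) (chosen_rep \<psi> n))"

lemma rep_chosen_rep:
  assumes "rep u \<phi>"
  shows "rep (chosen_rep \<phi>) \<phi>"
proof -
  have "\<exists>u. rep u \<phi>"
    using assms by blast
  then show ?thesis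
    unfolding chosen_rep_def by (rule someI_ex)
qed

lemma rep_unique:
  assumes "rep u \<phi>" "rep v \<phi>"
  shows "(\<lambda>n. nrm (sub (u n) (v n))) \<longlonglongrightarrow> 0"
proof (rule rep_zero_tendsto)
  show "rep (\<lambda>n. sub (u n) (v n)) 0"
    using rep_sub[OF assms] by (simp only: diff_self)
qed

text \<open>The inner product does not depend on the representatives: those fixed by choice differ
  from \<open>u\<close> and \<open>v\<close> by null sequences, which \<open>s_tendsto_0\<close>
  disposes of.\<close>

lemma cip_tendsto:
  assumes u: "rep u \<phi>" and v: "rep v \<psi>"
  shows "(\<lambda>n. s (u n) (v n)) \<longlonglongrightarrow> cip \<phi> \<psi>"
proof -
  let ?u = "chosen_rep \<phi>" and ?v = "chosen_rep \<psi>"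
  have u': "rep ?u \<phi>" and v': "rep ?v \<psi>"
    by (rule rep_chosen_rep[OF u] rep_chosen_rep[OF v])+
  note in_F = rep_in[OF u] rep_in[OF v] rep_in[OF u'] rep_in[OF v']
  have c: "cauchy v" "cauchy ?u" "cauchy ?v"
    using v u' v' by (auto simp: rep_def)
  have "(\<lambda>n. s (?u n) (?v n)) \<longlonglongrightarrow> cip \<phi> \<psi>"
    unfolding cip_def using convergent_s[OF c(2,3)] by (simp add: convergent_LIMSEQ_iff)
  moreover have "(\<lambda>n. s (sub (u n) (?u n)) (v n)) \<longlonglongrightarrow> 0"
    using rep_unique[OF u u'] in_F by (intro s_tendsto_0(2)[OF c(1)]) (auto simp: F_in)
  moreover have "(\<lambda>n. s (?u n) (sub (v n) (?v n))) \<longlonglongrightarrow> 0"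
    using rep_unique[OF v v'] in_F by (intro s_tendsto_0(1)[OF c(2)]) (auto simp: F_in)
  ultimately have "(\<lambda>n. s (?u n) (?v n) + s (sub (u n) (?u n)) (v n) + s (?u n) (sub (v n) (?v n))) \<longlonglongrightarrow>
      cip \<phi> \<psi> + 0 + 0"
    by (intro tendsto_add)
  then show ?thesis
    using in_F by (simp add: s_simps F_in)
qed

lemma cip_emb: "\<lbrakk>u \<in> F; v \<in> F\<rbrakk> \<Longrightarrow> cip (emb u) (emb v) = s u v"
  using cip_tendsto[OF rep_emb rep_emb, of u v] by (simp add: tendsto_const_iff)

lemma emb_in: "v \<in> F \<Longrightarrow> emb v \<in> carrier"
  unfolding carrier_def using rep_emb by blast

abbreviation fscale :: "complex \<Rightarrow> (nat \<Rightarrow> complex) \<Rightarrow> nat \<Rightarrow> complex"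
  where "fscale \<equiv> \<lambda>c x k. c * x k"

sublocale C: complex_inner_space fscale carrier cip
proof -
  interpret V: vector_space fscale
    by unfold_locales (auto simp: fun_eq_iff algebra_simps)
  show "complex_inner_space fscale carrier cip"
  proof
    show "V.subspace carrier"
    proof (rule V.subspaceI)
      \<comment> \<open>\<open>F\<close> has no designated zero element; 0 is obtained by scaling an
        element at hand, such as \<open>d 0\<close>.\<close>
      have "(\<lambda>k. 0 * emb (d 0) k) = 0"
        by (simp add: fun_eq_iff)
      then have "rep (\<lambda>n. scl 0 (d 0)) 0"
        using rep_scl[OF rep_emb[OF d_in], of 0 0] by metis
      then show "0 \<in> carrier"
        unfolding carrier_def by blast
      show "x + y \<in> carrier" if "x \<in> carrier" "y \<in> carrier" for x y
        using that rep_add unfolding carrier_def by blast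
      show "(\<lambda>k. c * x k) \<in> carrier" if "x \<in> carrier" for c x
      proof -
        obtain u where "rep u x"
          using \<open>x \<in> carrier\<close> by (auto simp: carrier_def)
        from rep_scl[OF this, of c] show ?thesis
          unfolding carrier_def by blast
      qed
    qed
  next
    fix x y z assume "x \<in> carrier" "y \<in> carrier" "z \<in> carrier"
    then obtain u v w where r: "rep u x" "rep v y" "rep w z"
      by (auto simp: carrier_def)
    have "(\<lambda>n. s (add (u n) (v n)) (w n)) \<longlonglongrightarrow> cip x z + cip y z"
      using tendsto_add[OF cip_tendsto[OF r(1,3)] cip_tendsto[OF r(2,3)]] r
      by (simp add: s_simps rep_in)
    then show "cip (x + y) z = cip x z + cip y z"
      using LIMSEQ_unique cip_tendsto[OF rep_add[OF r(1,2)] r(3)] by blast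
  next
    fix c x y assume "x \<in> carrier" "y \<in> carrier"
    then obtain u v where r: "rep u x" "rep v y"
      by (auto simp: carrier_def)
    have "(\<lambda>n. s (scl c (u n)) (v n)) \<longlonglongrightarrow> c * cip x y"
      using tendsto_mult_left[OF cip_tendsto[OF r], of c] r by (simp add: s_simps rep_in)
    then show "cip (\<lambda>k. c * x k) y = c * cip x y"
      using LIMSEQ_unique cip_tendsto[OF rep_scl[OF r(1)] r(2)] by blast
  next
    fix x y assume "x \<in> carrier" "y \<in> carrier"
    then obtain u v where r: "rep u x" "rep v y"
      by (auto simp: carrier_def)
    have "(\<lambda>n. s (u n) (v n)) \<longlonglongrightarrow> cnj (cip y x)"
    proof -
      have "s (u n) (v n) = cnj (s (v n) (u n))" for n
        by (rule s_cnj[OF rep_in[OF r(1)] rep_in[OF r(2)]])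
      then show ?thesis
        using tendsto_cnj[OF cip_tendsto[OF r(2,1)]] by presburger
    qed
    then show "cip x y = cnj (cip y x)"
      using LIMSEQ_unique cip_tendsto[OF r] by blast
  next
    fix x assume x: "x \<in> carrier" and nz: "x \<noteq> 0"
    obtain u where r: "rep u x"
      using x by (auto simp: carrier_def)
    have lim: "(\<lambda>n. Re (s (u n) (u n))) \<longlonglongrightarrow> Re (cip x x)"
      by (intro tendsto_intros cip_tendsto r)
    then have "0 \<le> Re (cip x x)"
      using rep_in[OF r] s_nonneg by (intro LIMSEQ_le_const[OF lim]) auto
    \<comment> \<open>Definiteness: a point of norm 0 comes from a null sequence, whose products
      with each \<open>d k\<close> tend to 0, and these limits are the coordinates of the
      point.\<close>
    moreover have "Re (cip x x) \<noteq> 0"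
    proof
      assume "Re (cip x x) = 0"
      then have "(\<lambda>n. nrm (u n)) \<longlonglongrightarrow> 0"
        using tendsto_real_sqrt[OF lim] by (simp add: nrm_def)
      then have "(\<lambda>n. s (u n) (d k)) \<longlonglongrightarrow> 0" for k
        using rep_in[OF r] by (intro s_tendsto_0(2) cauchy_const d_in)
      then have "x k = 0" for k
        using r LIMSEQ_unique unfolding rep_def by blast
      then show False
        using nz by (auto simp: fun_eq_iff)
    qed
    ultimately show "0 < Re (cip x x)" by linarith
  qed
qed

lemma hnorm_tendsto:
  assumes "rep u \<phi>"
  shows "(\<lambda>n. nrm (u n)) \<longlonglongrightarrow> C.hnorm \<phi>"
  unfolding nrm_def C.hnorm_def by (intro tendsto_intros cip_tendsto assms)

lemma hdist_tendsto:
  assumes "rep u \<phi>" "rep v \<psi>"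
  shows "(\<lambda>n. nrm (sub (u n) (v n))) \<longlonglongrightarrow> C.hdist \<phi> \<psi>"
proof -
  have "\<phi> \<in> carrier" "\<psi> \<in> carrier"
    using assms by (auto simp: carrier_def)
  then show ?thesis
    using hnorm_tendsto[OF rep_sub[OF assms]] by (simp add: C.hdist_def)
qed

lemma hdist_emb: "\<lbrakk>u \<in> F; v \<in> F\<rbrakk> \<Longrightarrow> C.hdist (emb u) (emb v) = nrm (sub u v)"
  using hdist_tendsto[OF rep_emb rep_emb, of u v] by (simp add: tendsto_const_iff)

lemma hdist_rep_emb_le:
  assumes "rep u \<phi>" "\<And>n. N \<le> n \<Longrightarrow> nrm (sub (u n) v) \<le> e" "v \<in> F"
  shows "C.hdist \<phi> (emb v) \<le> e"
  by (rule LIMSEQ_le_const2[OF hdist_tendsto[OF assms(1) rep_emb[OF assms(3)]]]) (use assms(2) in blast)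

lemma emb_dense:
  assumes "\<phi> \<in> carrier" "0 < e"
  obtains v where "v \<in> F" "C.hdist \<phi> (emb v) < e"
proof -
  obtain u where u: "rep u \<phi>"
    using assms by (auto simp: carrier_def)
  then have "cauchy u"
    by (simp add: rep_def)
  then obtain N where N: "\<And>m n. \<lbrakk>N \<le> m; N \<le> n\<rbrakk> \<Longrightarrow> nrm (sub (u m) (u n)) < e / 2"
    using cauchyD[of u "e / 2"] assms by auto
  have "C.hdist \<phi> (emb (u N)) \<le> e / 2"
    by (rule hdist_rep_emb_le[OF u, of N]) (use N rep_in[OF u] in \<open>auto intro: less_imp_le\<close>)
  then show ?thesis
    using that[of "u N"] rep_in[OF u] assms(2) by simp
qed

text \<open>Replace each \<open>f m\<close> by an embedded \<open>v m\<close> at distance below 1/(m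
  + 1); then \<open>v\<close> is itself Cauchy in \<open>F\<close>, and the point it represents is
  the limit of \<open>f\<close>.\<close>

lemma mcomplete_carrier: "C.mcomplete"
  unfolding C.mcomplete_def
proof (intro allI impI)
  fix f assume f: "C.MCauchy f"
  then have f_in: "f m \<in> carrier" for m
    by (auto simp: C.MCauchy_def)
  have "\<exists>v\<in>F. C.hdist (f m) (emb v) < inverse (real (Suc m))" for m
    using emb_dense[OF f_in[of m], of "inverse (real (Suc m))"] by auto
  then obtain v where v: "\<And>m. v m \<in> F" "\<And>m. C.hdist (f m) (emb (v m)) < inverse (real (Suc m))"
    by metis
  have small: "\<exists>N. \<forall>m\<ge>N. C.hdist (f m) (emb (v m)) < e" if "0 < e" for e
  proof -
    obtain N where N: "inverse (real (Suc N)) < e"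
      using reals_Archimedean[OF \<open>0 < e\<close>] by blast
    have "C.hdist (f m) (emb (v m)) < e" if "N \<le> m" for m
      using v(2)[of m] le_imp_inverse_le[of "real (Suc N)" "real (Suc m)"] N that by linarith
    then show ?thesis by blast
  qed
  have "cauchy v"
    unfolding cauchy_def
  proof (intro conjI allI impI)
    fix e :: real assume e: "0 < e"
    obtain M where M: "\<And>m. M \<le> m \<Longrightarrow> C.hdist (f m) (emb (v m)) < e / 3"
      using small[of "e / 3"] e by auto
    obtain N where N: "\<And>m n. \<lbrakk>N \<le> m; N \<le> n\<rbrakk> \<Longrightarrow> C.hdist (f m) (f n) < e / 3"
      using f e unfolding C.MCauchy_def by (metis divide_pos_pos zero_less_numeral)
    have "nrm (sub (v m) (v n)) < e" if "max M N \<le> m" "max M N \<le> n" for m n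
    proof -
      have "nrm (sub (v m) (v n)) = C.hdist (emb (v m)) (emb (v n))"
        using v by (simp add: hdist_emb)
      also have "\<dots> \<le> C.hdist (emb (v m)) (f m) + C.hdist (f m) (f n) + C.hdist (f n) (emb (v n))"
        using C.triangle[OF emb_in[OF v(1)] f_in emb_in[OF v(1)], of m n m]
          C.triangle[OF f_in f_in emb_in[OF v(1)], of m n n] by linarith
      also have "\<dots> < e"
      proof -
        have "M \<le> m" "M \<le> n" "N \<le> m" "N \<le> n"
          using that by auto
        then show ?thesis
          using M[of m] M[of n] N[of m n] C.commute[of "f m" "emb (v m)"] by linarith
      qed
      finally show ?thesis .
    qed
    then show "\<exists>N. \<forall>m\<ge>N. \<forall>n\<ge>N. nrm (sub (v m) (v n)) < e" by blast
  qed (use v in auto)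
  then obtain \<phi> where \<phi>: "rep v \<phi>"
    using cauchy_imp_rep by blast
  then have \<phi>_in: "\<phi> \<in> carrier"
    by (auto simp: carrier_def)
  have "\<exists>N. \<forall>m\<ge>N. C.hdist (f m) \<phi> < e" if e: "0 < e" for e
  proof -
    obtain M where M: "\<And>m. M \<le> m \<Longrightarrow> C.hdist (f m) (emb (v m)) < e / 2"
      using small[of "e / 2"] e by auto
    obtain N where N: "\<And>m n. \<lbrakk>N \<le> m; N \<le> n\<rbrakk> \<Longrightarrow> nrm (sub (v m) (v n)) < e / 2"
      using cauchyD[OF \<open>cauchy v\<close>, of "e / 2"] e by auto
    have "C.hdist (f m) \<phi> < e" if "max M N \<le> m" for m
    proof -
      have mn: "M \<le> m" "N \<le> m"
        using that by auto
      have "C.hdist \<phi> (emb (v m)) \<le> e / 2"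
        by (rule hdist_rep_emb_le[OF \<phi> _ v(1), of N]) (rule less_imp_le[OF N[OF _ mn(2)]])
      then show ?thesis
        using C.triangle[OF f_in emb_in[OF v(1)] \<phi>_in, of m m] M[OF mn(1)]
          C.commute[of \<phi> "emb (v m)"] by linarith
    qed
    then show ?thesis by blast
  qed
  then have "limitin C.mtopology f \<phi> sequentially"
    unfolding C.limitin_metric eventually_sequentially using f_in \<phi>_in by blast
  then show "\<exists>\<phi>. limitin C.mtopology f \<phi> sequentially"
    by (rule exI[of _ \<phi>])
qed

lemma separable_space_carrier: "separable_space C.mtopology"
proof -
  have "\<exists>y\<in>range (\<lambda>k. emb (d k)). y \<in> C.mball \<phi> r" if \<phi>: "\<phi> \<in> carrier" and r: "0 < r" for \<phi> r
  proof -
    obtain v where v: "v \<in> F" "C.hdist \<phi> (emb v) < r / 2"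
      using emb_dense[OF \<phi>, of "r / 2"] r by auto
    obtain k where "nrm (sub v (d k)) < r / 2"
      using dense[OF v(1), of "r / 2"] r by auto
    then have "C.hdist \<phi> (emb (d k)) < r"
      using C.triangle[OF \<phi> emb_in[OF v(1)] emb_in[OF d_in], of k] v d_in by (simp add: hdist_emb)
    then show ?thesis
      using \<phi> emb_in[OF d_in] unfolding C.in_mball by blast
  qed
  then have "C.mtopology closure_of (range (\<lambda>k. emb (d k))) = carrier"
    unfolding C.metric_closure_of by blast
  then show ?thesis
    unfolding separable_space_def C.topspace_mtopology using emb_in[OF d_in]
    by (intro exI[of _ "range (\<lambda>k. emb (d k))"]) blast
qed

sublocale C: hilbert_space fscale carrier cip
  by unfold_locales (rule mcomplete_carrier separable_space_carrier)+

text \<open>If, as seen by \<open>s\<close>, the adjoint of \<open>M\<close> sends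
  \<open>d k\<close> to \<open>d (\<sigma> k)\<close>, then the coordinates of M u are those of u
  read along \<open>\<sigma>\<close>. So \<open>M\<close> extends to the completion by an explicit
  map of functions, independent of representatives.\<close>

lemma rep_reindex:
  assumes "rep u \<phi>" and M: "\<And>u. u \<in> F \<Longrightarrow> M u \<in> F"
    and lip: "\<And>u v. \<lbrakk>u \<in> F; v \<in> F\<rbrakk> \<Longrightarrow> nrm (sub (M u) (M v)) \<le> L * nrm (sub u v)"
    and \<sigma>: "\<And>u k. u \<in> F \<Longrightarrow> s (M u) (d k) = s u (d (\<sigma> k))"
  shows "rep (\<lambda>n. M (u n)) (\<phi> \<circ> \<sigma>)"
proof -
  have u: "cauchy u"
    using assms(1) by (simp add: rep_def)
  note in_F = cauchy_in[OF u]
  have "\<exists>N. \<forall>m\<ge>N. \<forall>n\<ge>N. nrm (sub (M (u m)) (M (u n))) < e" if "0 < e" for e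
  proof -
    let ?L = "\<bar>L\<bar> + 1"
    obtain N where N: "\<And>m n. \<lbrakk>N \<le> m; N \<le> n\<rbrakk> \<Longrightarrow> nrm (sub (u m) (u n)) < e / ?L"
      using cauchyD[OF u, of "e / ?L"] \<open>0 < e\<close> by auto
    have "nrm (sub (M (u m)) (M (u n))) < e" if "N \<le> m" "N \<le> n" for m n
    proof -
      have "nrm (sub (M (u m)) (M (u n))) \<le> L * nrm (sub (u m) (u n))"
        using lip in_F by blast
      also have "\<dots> \<le> ?L * nrm (sub (u m) (u n))"
        using in_F by (intro mult_right_mono) (auto simp: nrm_nonneg F_in)
      also have "\<dots> < ?L * (e / ?L)"
        using N[OF that] by (intro mult_strict_left_mono) auto
      also have "\<dots> = e"
        by (simp add: add_nonneg_eq_0_iff)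
      finally show ?thesis .
    qed
    then show ?thesis by blast
  qed
  then have "cauchy (\<lambda>n. M (u n))"
    using in_F M by (auto simp: cauchy_def)
  then show ?thesis
    using assms(1) \<sigma> in_F by (simp add: rep_def)
qed

text \<open>Composition with \<open>\<sigma>\<close> is linear by its form; invariance of the
  carrier and the norm bound come from representing sequences.\<close>

lemma bounded_op_reindex:
  assumes M: "\<And>u. u \<in> F \<Longrightarrow> M u \<in> F"
    and lip: "\<And>u v. \<lbrakk>u \<in> F; v \<in> F\<rbrakk> \<Longrightarrow> nrm (sub (M u) (M v)) \<le> L * nrm (sub u v)"
    and bound: "\<And>u. u \<in> F \<Longrightarrow> nrm (M u) \<le> L * nrm u"
    and \<sigma>: "\<And>u k. u \<in> F \<Longrightarrow> s (M u) (d k) = s u (d (\<sigma> k))"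
  shows "C.bounded_op (\<lambda>\<phi>. \<phi> \<circ> \<sigma>)"
proof -
  note r = rep_reindex[where M = M and L = L and \<sigma> = \<sigma>, OF _ M lip \<sigma>]
  have "C.hnorm (\<phi> \<circ> \<sigma>) \<le> L * C.hnorm \<phi>" if "\<phi> \<in> carrier" for \<phi>
  proof -
    obtain u where u: "rep u \<phi>"
      using \<open>\<phi> \<in> carrier\<close> by (auto simp: carrier_def)
    have "(\<lambda>n. nrm (M (u n))) \<longlonglongrightarrow> C.hnorm (\<phi> \<circ> \<sigma>)" "(\<lambda>n. L * nrm (u n)) \<longlonglongrightarrow> L * C.hnorm \<phi>"
      by (intro hnorm_tendsto r u tendsto_intros; simp)+
    then show ?thesis
      by (rule LIMSEQ_le) (use bound rep_in[OF u] in blast)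
  qed
  moreover have "\<phi> \<circ> \<sigma> \<in> carrier" if "\<phi> \<in> carrier" for \<phi>
    using that r by (auto simp: carrier_def)
  ultimately show ?thesis
    by (auto simp: C.bounded_op_def fun_eq_iff)
qed

lemma cip_reindex:
  assumes M: "\<And>u. u \<in> F \<Longrightarrow> M u \<in> F" "\<And>u. u \<in> F \<Longrightarrow> M' u \<in> F"
    and lip: "\<And>u v. \<lbrakk>u \<in> F; v \<in> F\<rbrakk> \<Longrightarrow> nrm (sub (M u) (M v)) \<le> L * nrm (sub u v)"
      "\<And>u v. \<lbrakk>u \<in> F; v \<in> F\<rbrakk> \<Longrightarrow> nrm (sub (M' u) (M' v)) \<le> L * nrm (sub u v)"
    and \<sigma>: "\<And>u k. u \<in> F \<Longrightarrow> s (M u) (d k) = s u (d (\<sigma> k))"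
      "\<And>u k. u \<in> F \<Longrightarrow> s (M' u) (d k) = s u (d (\<sigma>' k))"
    and adjoint: "\<And>u v. \<lbrakk>u \<in> F; v \<in> F\<rbrakk> \<Longrightarrow> s (M u) v = s u (M' v)"
    and \<phi>: "\<phi> \<in> carrier" and \<psi>: "\<psi> \<in> carrier"
  shows "cip (\<phi> \<circ> \<sigma>) \<psi> = cip \<phi> (\<psi> \<circ> \<sigma>')"
proof -
  obtain u v where u: "rep u \<phi>" and v: "rep v \<psi>"
    using \<phi> \<psi> by (auto simp: carrier_def)
  have "(\<lambda>n. s (M (u n)) (v n)) \<longlonglongrightarrow> cip (\<phi> \<circ> \<sigma>) \<psi>"
    by (rule cip_tendsto[OF rep_reindex[where M = M, OF u M(1) lip(1) \<sigma>(1)] v])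
  moreover have "(\<lambda>n. s (u n) (M' (v n))) \<longlonglongrightarrow> cip \<phi> (\<psi> \<circ> \<sigma>')"
    by (rule cip_tendsto[OF u rep_reindex[where M = M', OF v M(2) lip(2) \<sigma>(2)]])
  ultimately show ?thesis
    using adjoint[OF rep_in[OF u] rep_in[OF v]] LIMSEQ_unique by (simp only:) blast
qed

end


section \<open>The normal extension\<close>

text \<open>Over a finite index type an exponent is a function from a finite to a countable type.
  Hence lists of monomials paired with numbers can be coded by numbers.\<close>

instance poly_mapping :: (finite, "{countable, zero}") countable
  by (rule countable_classI[of "\<lambda>f. to_nat (Poly_Mapping.lookup f)"])
    (simp add: Poly_Mapping.lookup_inject)

lemma list_form_map_left: "list_form B (map f u) v = list_form (\<lambda>p. B (f p)) u v"
  by (simp add: list_form_def o_def)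

lemma list_form_map_right: "list_form B u (map f v) = list_form (\<lambda>p q. B p (f q)) u v"
  by (simp add: list_form_def o_def)

lemma list_form_mult: "list_form (\<lambda>p q. c * B p q) u v = c * list_form B u v"
  by (simp add: list_form_def sum_list_const_mult)

lemma list_form_swap_cnj:
  assumes "\<And>p q. p \<in> set u \<Longrightarrow> q \<in> set v \<Longrightarrow> B p q = cnj (C q p)"
  shows "list_form B u v = cnj (list_form C v u)"
  using assms
proof (induction u)
  case (Cons p u)
  have "(\<Sum>q\<leftarrow>v. B p q) = cnj (\<Sum>q\<leftarrow>v. C q p)"
    using Cons.prems[of p] by (induction v) auto
  moreover have "list_form B u v = cnj (list_form C v u)"
    using Cons by simp
  ultimately show ?case
    by (simp add: list_form_def sum_list_addf)
qed (simp add: list_form_def)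

lemma (in hilbert_space) dense_sequence:
  "\<exists>en :: nat \<Rightarrow> 'a. (\<forall>m. en m \<in> H) \<and> (\<forall>x\<in>H. \<forall>e>0. \<exists>m. hnorm (x - en m) < e)"
proof -
  obtain C where C: "countable C" "C \<subseteq> H" "mtopology closure_of C = H"
    using separable by (auto simp: separable_space_def)
  have near: "\<exists>y\<in>C. hnorm (x - y) < e" if "x \<in> H" "0 < e" for x e
  proof -
    have "x \<in> mtopology closure_of C"
      using C(3) \<open>x \<in> H\<close> by simp
    then obtain y where "y \<in> C" "y \<in> mball x e"
      using \<open>0 < e\<close> unfolding metric_closure_of by blast
    then show ?thesis
      by (auto simp: in_mball hdist_def)
  qed
  \<comment> \<open>\<open>H\<close> contains 0, so the dense set is nonempty and can be enumerated,
    with repetitions if it is finite.\<close>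
  then have "C \<noteq> {}"
    using carrier_simps(1) zero_less_one by blast
  then have range: "range (from_nat_into C) = C"
    using C(1) by (rule range_from_nat_into)
  have "from_nat_into C m \<in> H" for m
    using range C(2) by blast
  moreover have "\<exists>m. hnorm (x - from_nat_into C m) < e" if "x \<in> H" "0 < e" for x e
    using near[OF that] range by (metis imageE)
  ultimately show ?thesis
    by (intro exI[of _ "from_nat_into C"]) simp
qed

section \<open>The polynomial ring tensored with the Hilbert space\<close>

context positive_tuple
begin

text \<open>A list of pairs \<open>((\<alpha>, \<beta>), x)\<close> stands for the sum of the \<open>z\<^sup>\<alpha> zbar\<^sup>\<beta> \<otimes> x\<close>.\<close>

definition vecs :: "((('n \<Rightarrow>\<^sub>0 nat) \<times> ('n \<Rightarrow>\<^sub>0 nat)) \<times> 'a) list set"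
  where "vecs = {u. \<forall>p\<in>set u. snd p \<in> H}"

definition vscale :: "complex \<Rightarrow> ('k \<times> 'a) list \<Rightarrow> ('k \<times> 'a) list"
  where "vscale c = map (\<lambda>p. (fst p, c *s snd p))"

text \<open>Multiplication of the polynomial factor by a monomial; the type is general enough to act
  on coded vectors as well.\<close>

definition shift :: "'k::plus \<Rightarrow> ('k \<times> 'b) list \<Rightarrow> ('k \<times> 'b) list"
  where "shift k = map (\<lambda>p. (k + fst p, snd p))"

definition kern
  where "kern = list_form (\<lambda>p q. hform (zmono (fst p) * star (zmono (fst q))) (snd p) (snd q))"

lemma mono_mult_star: "zmono k * star (zmono l) = zmono (k + prod.swap l)"
  by (cases l) (simp add: star_single mult_single)

lemma hform_mono: "hform (zmono k * star (zmono l)) x y = ip (pow (fst k + snd l) x) (pow (snd k + fst l) y)"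
  by (simp add: mono_mult_star hform_single)

sublocale V: semi_inner vecs "(@)" vscale kern
proof
  fix u v w c assume u: "u \<in> vecs" and v: "v \<in> vecs" and w: "w \<in> vecs"
  show "u @ v \<in> vecs" "vscale c u \<in> vecs"
    using u v by (auto simp: vecs_def vscale_def carrier_simps)
  show "kern (u @ v) w = kern u w + kern v w"
    by (simp add: kern_def list_form_append_left)
  have "kern (vscale c u) w = list_form (\<lambda>p q. c * hform (zmono (fst p) * star (zmono (fst q))) (snd p) (snd q)) u w"
    using u w unfolding kern_def vscale_def list_form_map_left
    by (intro list_form_cong) (simp add: vecs_def hform_scale_left)
  then show "kern (vscale c u) w = c * kern u w"
    by (simp add: kern_def list_form_mult)
  show "kern u w = cnj (kern w u)"
    unfolding kern_def
  proof (rule list_form_swap_cnj)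
    fix p q assume "p \<in> set u" "q \<in> set w"
    then show "hform (zmono (fst p) * star (zmono (fst q))) (snd p) (snd q) =
        cnj (hform (zmono (fst q) * star (zmono (fst p))) (snd q) (snd p))"
      using u w hform_star[of "snd p" "snd q" "zmono (fst q) * star (zmono (fst p))"]
      by (auto simp: vecs_def star_mult star_star mult.commute)
  qed
  \<comment> \<open>Semidefiniteness is the matrix inequality with weight w = 1.\<close>
  have "zeval 1 a = 1" for a :: "complex ^ 'n"
    using zeval_const[of 1 a] by simp
  then show "0 \<le> Re (kern u u)"
    using list_form_hform_nonneg[of 1 u] u by (simp add: kern_def vecs_def real_polys_def star_one)
qed

lemma shift_in: "u \<in> vecs \<Longrightarrow> shift k u \<in> vecs"
  by (auto simp: shift_def vecs_def)

lemma shift_sub: "V.sub (shift k u) (shift k v) = shift k (V.sub u v)"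
  by (simp add: V.sub_def shift_def vscale_def)

text \<open>In the commutative ring \<open>(m * f) * star g = f * star (star m * g)\<close>:
  multiplication by a monomial and by its conjugate are formal adjoints.\<close>

lemma kern_shift_left: "kern (shift k u) v = kern u (shift (prod.swap k) v)"
proof -
  have *: "prod.swap (prod.swap k + l) = k + prod.swap l" for l
    by (cases k; cases l) simp
  have "zmono (k + l) * star (zmono l') = zmono l * star (zmono (prod.swap k + l'))" for l l'
    by (simp only: mono_mult_star *) (simp add: ac_simps)
  then show ?thesis
    by (simp add: kern_def shift_def list_form_map_left list_form_map_right)
qed

text \<open>The weight \<open>R\<^sup>2 - z\<^sub>i zbar\<^sub>i\<close>, nonnegative on the polydisc, bounds multiplication by \<open>z\<^sub>i\<close> and \<open>zbar\<^sub>i\<close>.\<close>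

lemma nrm_shift_le:
  assumes u: "u \<in> vecs"
    and k: "k + prod.swap k = (Poly_Mapping.single i 1, Poly_Mapping.single i 1)"
  shows "V.nrm (shift k u) \<le> R * V.nrm u"
proof -
  let ?w = "const_poly (of_real (R\<^sup>2)) - Poly_Mapping.single (Poly_Mapping.single i 1, Poly_Mapping.single i 1) (of_real 1)"
  have R: "0 \<le> R"
    using K_less_R by linarith
  have w: "?w \<in> real_polys"
    by (intro real_polys_diff real_polys_const real_polys_single_diag)
  have w_nonneg: "0 \<le> Re (zeval ?w a)" if "a \<in> polydisc R" for a
  proof -
    have "zeval ?w a = of_real (R\<^sup>2 - norm (a $ i) ^ (2 * 1))"
      by (simp only: zeval_diff zeval_single mono_eval_0 mono_eval_diag of_real_1 mult_1_left mult_1_right of_real_diff)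
    moreover have "norm (a $ i) ^ 2 \<le> R\<^sup>2"
      using that by (intro power_mono) (auto simp: polydisc_def)
    ultimately show ?thesis
      by (simp only: Re_complex_of_real mult_1_right)
  qed
  have *: "hform (?w * zmono l * star (zmono l')) x y =
      of_real (R\<^sup>2) * hform (zmono l * star (zmono l')) x y - hform (zmono (k + l) * star (zmono (k + l'))) x y"
    for l l' x y
  proof -
    have "k + prod.swap k + l + prod.swap l' = (k + l) + prod.swap (k + l')"
      by (cases k; cases l; cases l') (simp add: ac_simps)
    then have "zmono (k + prod.swap k) * (zmono l * star (zmono l')) = zmono (k + l) * star (zmono (k + l'))"
      by (simp add: mono_mult_star mult_single add.assoc)
    then have "?w * zmono l * star (zmono l') =
        const_poly (of_real (R\<^sup>2)) * (zmono l * star (zmono l')) - zmono (k + l) * star (zmono (k + l'))"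
      by (simp only: k mult.assoc left_diff_distrib of_real_1)
    then show ?thesis
      by (simp only: hform_diff hform_const_mult)
  qed
  \<comment> \<open>The form weighted by R^2 - |z_i|^2, that is, R^2 times the form at
    \<open>u\<close> minus the form at the shifted \<open>u\<close>.\<close>
  define Q where "Q = list_form (\<lambda>p q. hform (?w * zmono (fst p) * star (zmono (fst q))) (snd p) (snd q)) u u"
  have "Q + kern (shift k u) (shift k u) = of_real (R\<^sup>2) * kern u u"
    unfolding Q_def kern_def shift_def list_form_map_left list_form_map_right fst_conv snd_conv *
    by (simp flip: list_form_add list_form_mult)
  from arg_cong[OF this, of Re]
  have "Re Q + Re (kern (shift k u) (shift k u)) = R\<^sup>2 * Re (kern u u)"
    by (simp del: of_real_power)
  moreover have "0 \<le> Re Q"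
    unfolding Q_def using u w_nonneg by (intro list_form_hform_nonneg[OF w]) (auto simp: vecs_def)
  ultimately have "Re (kern (shift k u) (shift k u)) \<le> R\<^sup>2 * Re (kern u u)"
    by linarith
  then have "sqrt (Re (kern (shift k u) (shift k u))) \<le> sqrt (R\<^sup>2 * Re (kern u u))"
    by (rule real_sqrt_le_mono)
  then show ?thesis
    using R by (simp add: V.nrm_def real_sqrt_mult)
qed

text \<open>For m = z^\<alpha> zbar^\<beta> the product \<open>m * star m\<close> is z^\<gamma>
  zbar^\<gamma> with \<gamma> = \<alpha> + \<beta>. This allows approximation of the vector in m
  \<otimes> x with the monomial kept fixed.\<close>

lemma nrm_sub_single:
  assumes "x \<in> H" "y \<in> H"
  shows "V.nrm (V.sub [(k, x)] [(k, y)]) = hnorm (pow (fst k + snd k) (x - y))"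
proof -
  let ?P = "pow (fst k + snd k)"
  have kern: "kern [(k, a)] [(k, b)] = ip (?P a) (?P b)" for a b
    by (simp add: kern_def list_form_def hform_mono add.commute)
  have P: "?P x \<in> H" "?P y \<in> H" "?P (x - y) = ?P x - ?P y"
    using assms pow_simps(2)[of "x - y" y "fst k + snd k"] by (simp_all add: pow_simps(1) carrier_simps)
  have in_vecs: "[(k, x)] \<in> vecs" "[(k, y)] \<in> vecs"
    using assms by (auto simp: vecs_def)
  have "kern (V.sub [(k, x)] [(k, y)]) (V.sub [(k, x)] [(k, y)]) =
      ip (?P x) (?P x) - ip (?P x) (?P y) - (ip (?P y) (?P x) - ip (?P y) (?P y))"
    using in_vecs by (simp add: V.s_sub V.s_sub_right V.sub_in kern)
  also have "\<dots> = ip (?P (x - y)) (?P (x - y))"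
    using P by (simp add: ip_diff_left ip_diff_right carrier_simps)
  finally show ?thesis
    by (simp add: V.nrm_def hnorm_def)
qed

end

section \<open>A dense sequence closed under multiplication by monomials\<close>

locale enumerated_tuple = positive_tuple scale H ip T K R
  for scale :: "complex \<Rightarrow> 'a::ab_group_add \<Rightarrow> 'a" (infixr "*s" 75) and H ip
    and T :: "'n::finite \<Rightarrow> 'a \<Rightarrow> 'a" and K R +
  fixes en :: "nat \<Rightarrow> 'a"
  assumes en_in: "en m \<in> H"
    and en_dense: "\<lbrakk>x \<in> H; 0 < e\<rbrakk> \<Longrightarrow> \<exists>m. hnorm (x - en m) < e"
begin

definition realize :: "('k \<times> nat) list \<Rightarrow> ('k \<times> 'a) list"
  where "realize = map (\<lambda>p. (fst p, en (snd p)))"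

definition decode :: "nat \<Rightarrow> ((('n \<Rightarrow>\<^sub>0 nat) \<times> ('n \<Rightarrow>\<^sub>0 nat)) \<times> 'a) list"
  where "decode k = realize (from_nat k)"

text \<open>Multiplication by a monomial, carried over to codes: it provides the index map with
  which points of the completion are composed.\<close>

definition index_shift :: "('n \<Rightarrow>\<^sub>0 nat) \<times> ('n \<Rightarrow>\<^sub>0 nat) \<Rightarrow> nat \<Rightarrow> nat"
  where "index_shift k j = to_nat (shift k (from_nat j :: ((('n \<Rightarrow>\<^sub>0 nat) \<times> ('n \<Rightarrow>\<^sub>0 nat)) \<times> nat) list))"

lemma decode_index_shift: "decode (index_shift k j) = shift k (decode j)"
  by (simp add: decode_def index_shift_def realize_def shift_def)

text \<open>The source of both commutation and normality of the extension: exponents add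
  commutatively.\<close>

lemma index_shift_commute: "index_shift k (index_shift l j) = index_shift l (index_shift k j)"
  by (simp add: index_shift_def shift_def o_def ac_simps)

lemma realize_in: "realize l \<in> vecs"
  by (auto simp: realize_def vecs_def en_in)

text \<open>Induction over the list. The error in the head is controlled by the bound
  \<open>L\<close> of the power of \<open>T\<close> that its monomial induces.\<close>

lemma realize_dense:
  assumes "u \<in> vecs" "0 < e"
  shows "\<exists>l. V.nrm (V.sub u (realize l)) < e"
  using assms
proof (induction u arbitrary: e)
  case Nil
  have "V.sub [] (realize []) = []"
    by (simp add: V.sub_def realize_def vscale_def)
  moreover have "kern [] [] = 0"
    by (simp add: kern_def list_form_def)
  ultimately have "V.nrm (V.sub [] (realize [])) = 0"
    by (simp add: V.nrm_def)
  then show ?case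
    using Nil by metis
next
  case (Cons p u)
  obtain k x where p: "p = (k, x)"
    by fastforce
  have x: "x \<in> H" and u: "u \<in> vecs" and px: "[(k, x)] \<in> vecs"
    using Cons.prems p by (auto simp: vecs_def)
  obtain L where L: "0 < L" "\<And>y. y \<in> H \<Longrightarrow> hnorm (pow (fst k + snd k) y) \<le> L * hnorm y"
    using bounded_op_bound[OF pow_bounded] by blast
  obtain m where m: "hnorm (x - en m) < e / 2 / L"
    using en_dense[OF x, of "e / 2 / L"] L(1) Cons.prems(2) by auto
  have "V.nrm (V.sub [(k, x)] (realize [(k, m)])) \<le> L * hnorm (x - en m)"
    using nrm_sub_single[OF x en_in, of k m] L(2) x en_in by (simp add: realize_def carrier_simps)
  also have "\<dots> < L * (e / 2 / L)"
    using m L(1) by (intro mult_strict_left_mono)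
  also have "\<dots> = e / 2"
    using L(1) by simp
  finally have 1: "V.nrm (V.sub [(k, x)] (realize [(k, m)])) < e / 2" .
  obtain l where 2: "V.nrm (V.sub u (realize l)) < e / 2"
    using Cons.IH[OF u, of "e / 2"] Cons.prems(2) by auto
  have "V.nrm (V.sub ([(k, x)] @ u) (realize [(k, m)] @ realize l)) < e"
    using V.nrm_sub_add_le[OF px u realize_in realize_in, of "[(k, m)]" l] 1 2 by linarith
  then show ?case
    unfolding p by (intro exI[of _ "(k, m) # l"]) (simp add: realize_def)
qed

sublocale V: separable_semi_inner vecs "(@)" vscale kern decode
proof
  show "decode k \<in> vecs" for k
    by (simp add: decode_def realize_in)
  show "\<exists>k. V.nrm (V.sub u (decode k)) < e" if "u \<in> vecs" "0 < e" for u e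
    using realize_dense[OF that] by (metis decode_def from_nat_to_nat)
qed

lemma kern_shift_decode: "kern (shift k u) (decode j) = kern u (decode (index_shift (prod.swap k) j))"
  by (simp add: kern_shift_left decode_index_shift)

lemma subnormal: "subnormal T"
proof -
  define \<epsilon> :: "'n \<Rightarrow> ('n \<Rightarrow>\<^sub>0 nat) \<times> ('n \<Rightarrow>\<^sub>0 nat)" where "\<epsilon> i = (Poly_Mapping.single i 1, 0)" for i
  define J where "J x = V.emb [(0, x)]" for x
  \<comment> \<open>Multiplication by z_i: its coordinates are read at the dense elements multiplied
    by zbar_i, hence the swapped exponent. \<open>T''\<close> is multiplication by zbar_i.\<close>
  define T' where "T' i = (\<lambda>\<phi> :: nat \<Rightarrow> complex. \<phi> \<circ> index_shift (prod.swap (\<epsilon> i)))" for i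
  define T'' where "T'' i = (\<lambda>\<phi> :: nat \<Rightarrow> complex. \<phi> \<circ> index_shift (\<epsilon> i))" for i
  have single_in: "[(k, x)] \<in> vecs" if "x \<in> H" for k x
    using that by (simp add: vecs_def)
  have eps: "\<epsilon> i + prod.swap (\<epsilon> i) = (Poly_Mapping.single i 1, Poly_Mapping.single i 1)"
    "prod.swap (\<epsilon> i) + prod.swap (prod.swap (\<epsilon> i)) = (Poly_Mapping.single i 1, Poly_Mapping.single i 1)" for i
    by (simp_all add: \<epsilon>_def)
  have lip: "V.nrm (V.sub (shift k u) (shift k v)) \<le> R * V.nrm (V.sub u v)"
    if "u \<in> vecs" "v \<in> vecs" "k = \<epsilon> i \<or> k = prod.swap (\<epsilon> i)" for k i u v
    unfolding shift_sub using that eps by (intro nrm_shift_le[of _ _ i] V.sub_in) auto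
  have adj: "kern (shift (prod.swap k) u) (decode j) = kern u (decode (index_shift k j))" for k u j
    using kern_shift_decode[of "prod.swap k"] by simp
  have bT': "V.C.bounded_op (T' i)" for i
    unfolding T'_def
    by (rule V.bounded_op_reindex[of "shift (\<epsilon> i)" R])
      (use lip[of _ _ "\<epsilon> i" i] nrm_shift_le[OF _ eps(1)] in \<open>auto simp: shift_in kern_shift_decode\<close>)
  have bT'': "V.C.bounded_op (T'' i)" for i
    unfolding T''_def
    by (rule V.bounded_op_reindex[of "shift (prod.swap (\<epsilon> i))" R])
      (use lip[of _ _ "prod.swap (\<epsilon> i)" i] nrm_shift_le[OF _ eps(2)] in \<open>auto simp: shift_in adj\<close>)
  have "V.cip (T' i \<phi>) \<psi> = V.cip \<phi> (T'' i \<psi>)" if "\<phi> \<in> V.carrier" "\<psi> \<in> V.carrier" for i \<phi> \<psi>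
    unfolding T'_def T''_def using that
    by (intro V.cip_reindex[of "shift (\<epsilon> i)" "shift (prod.swap (\<epsilon> i))" R])
      (use lip[of _ _ _ i] in \<open>auto simp: shift_in kern_shift_left decode_index_shift\<close>)
  then have hadjoint: "V.C.hadjoint (T' i) \<psi> = T'' i \<psi>" if "\<psi> \<in> V.carrier" for i \<psi>
    using that V.C.bounded_opE(1)[OF bT''] by (intro V.C.hadjoint_eqI) auto
  have normal: "V.C.normal_op (T' i)" for i
    unfolding V.C.normal_op_def
  proof (intro conjI ballI bT')
    fix \<phi> assume "\<phi> \<in> V.carrier"
    then show "V.C.hadjoint (T' i) (T' i \<phi>) = T' i (V.C.hadjoint (T' i) \<phi>)"
      using V.C.bounded_opE(1)[OF bT'] by (simp add: hadjoint) (simp add: T'_def T''_def o_def index_shift_commute)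
  qed
  have commuting': "V.C.commuting_tuple T'"
    unfolding V.C.commuting_tuple_def using bT' by (auto simp: T'_def o_def fun_eq_iff index_shift_commute)
  have JH: "J x \<in> V.carrier" if "x \<in> H" for x
    unfolding J_def by (intro V.emb_in single_in that)
  have J_add: "J (x + y) = J x + J y" if "x \<in> H" "y \<in> H" for x y
  proof
    fix j
    \<comment> \<open>The list for x + y is not the concatenation of those for x and y; they agree
      only under \<open>kern\<close>.\<close>
    have "kern [(0, x + y)] v = kern [(0, x)] v + kern [(0, y)] v" if "v \<in> vecs" for v
      using that \<open>x \<in> H\<close> \<open>y \<in> H\<close>
      by (induction v) (simp_all add: kern_def list_form_def vecs_def hform_add_left)
    then show "J (x + y) j = (J x + J y) j"
      using V.d_in[of j] by (simp add: J_def V.emb_def)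
  qed
  have J_scale: "J (c *s x) = (\<lambda>k. c * J x k)" if "x \<in> H" for c x
    using V.s_scl[OF single_in[OF that, of 0] V.d_in, of c] by (simp add: J_def V.emb_def vscale_def fun_eq_iff)
  have J_ip: "V.cip (J x) (J y) = ip x y" if "x \<in> H" "y \<in> H" for x y
    unfolding J_def using that
    by (subst V.cip_emb) (simp_all add: single_in kern_def list_form_def hform_mono tuple_power_0)
  have J_T: "T' i (J x) = J (T i x)" if "x \<in> H" for i x
  proof
    fix j
    \<comment> \<open>z_i \<otimes> x and 1 \<otimes> T_i x are different lists with the same
      products: a power of z in the left argument acts on its vector through
      \<open>T\<close>.\<close>
    have "T i x = pow (Poly_Mapping.single i 1) x"
      by (simp add: tuple_power_single)
    then have "hform (zmono (\<epsilon> i) * star (zmono l)) x y = hform (zmono 0 * star (zmono l)) (T i x) y" for l y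
      using tuple_power_add[OF commuting that, of "snd l" "Poly_Mapping.single i 1"]
      unfolding hform_mono by (simp add: \<epsilon>_def add.commute)
    then have "kern (shift (\<epsilon> i) [(0, x)]) v = kern [(0, T i x)] v" for v
      by (simp add: kern_def list_form_def shift_def)
    then show "T' i (J x) j = J (T i x) j"
      by (simp add: T'_def J_def V.emb_def flip: kern_shift_decode)
  qed
  have TH: "T i x \<in> H" if "x \<in> H" for i x
    using that commuting bounded_opE(1) unfolding commuting_tuple_def by blast
  have invariant: "T' i ` (J ` H) \<subseteq> J ` H" for i
    using J_T TH by auto
  show ?thesis
    unfolding subnormal_def
    by (intro exI[of _ "\<lambda>c x k. c * x k"] exI[of _ V.carrier] exI[of _ V.cip] exI[of _ J] exI[of _ T']
        conjI refl V.C.hilbert_space_axioms commuting')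
      (use JH J_add J_scale J_ip J_T normal invariant in auto)
qed

end

section \<open>The Quillen property supplies a positive tuple\<close>

theorem proposition3p9:
  fixes I :: "'n::finite zpoly set"
  assumes "real_ideal I"
    and "quillen_property I"
  shows "subnormality_property TYPE('a::ab_group_add) I"
  unfolding subnormality_property_def
proof (intro allI impI, elim conjE)
  fix scale :: "complex \<Rightarrow> 'a \<Rightarrow> 'a" and H ip and T :: "'n \<Rightarrow> 'a \<Rightarrow> 'a"
  assume "hilbert_space scale H ip" and comm: "complex_inner_space.commuting_tuple scale H ip T"
    and annihilates: "\<forall>p\<in>I. \<forall>x\<in>H. complex_inner_space.hereditary scale H ip p T x = 0"
  then interpret hilbert_space scale H ip
    by blast
  interpret hilbert_tuple scale H ip T
    by unfold_locales (rule comm)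
  have "\<exists>k>0. \<forall>x\<in>H. hnorm (T i x) \<le> k * hnorm x" for i
    using comm bounded_op_bound[of "T i"] unfolding commuting_tuple_def by metis
  then obtain k where k: "\<And>i. 0 < k i" "\<And>i x. x \<in> H \<Longrightarrow> hnorm (T i x) \<le> k i * hnorm x"
    by metis
  \<comment> \<open>One bound for all of the finitely many operators; K + 1 then serves as the
    radius R above it.\<close>
  define K where "K = (\<Sum>i\<in>UNIV. k i)"
  have K: "0 \<le> K"
    unfolding K_def using k(1) by (intro sum_nonneg less_imp_le)
  have bound: "hnorm (T i x) \<le> K * hnorm x" if "x \<in> H" for i x
  proof -
    have "k i \<le> K"
      unfolding K_def using k(1) by (intro member_le_sum less_imp_le) auto
    then show ?thesis
      using k(2)[OF that, of i] mult_right_mono[of "k i" K "hnorm x"] hnorm_nonneg[OF that] by linarith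
  qed
  obtain en :: "nat \<Rightarrow> 'a" where en: "\<forall>m. en m \<in> H" "\<forall>x\<in>H. \<forall>e>0. \<exists>m. hnorm (x - en m) < e"
    using dense_sequence by blast
  interpret enumerated_tuple scale H ip T K "K + 1" en
  proof unfold_locales
    show "0 \<le> Re (hform f x x)" if "f \<in> real_polys" "\<And>a. 0 < Re (zeval f a)" "x \<in> H" for f x
      using quillen_imp_hform_nonneg[OF assms(2) _ that] annihilates by blast
  qed (use K bound en in auto)
  show "complex_inner_space.subnormal scale H ip T"
    by (rule subnormal)
qed

end
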